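(* Let $1<r\le\infty$, $\mathfrak{D}:=\{z\in\mathbb{C}:|z|<r\}$, let $A,B\in\mathrm{M}_2(\mathbb{C})$, and let $G:\mathfrak{D}\to\mathrm{M}_2(\mathbb{C})$ be holomorphic. Assume: (a) $a_0$ is an eigenvector of $A$ for the eigenvalue $\alpha_0$, and $A-\alpha_0-k$ is invertible for all positive integers $k$; (b) $B$ has distinct eigenvalues $\beta_1\neq\beta_2$ such that $\delta:=\beta_2-\beta_1$ satisfies $\operatorname{Re}(\delta)>-1$, and $b_j$ is an eigenvector of $B$ for $\beta_j$, $j=1,2$; (c) $G(z)=\sum_{k\ge0}z^kG_k$ on $|z|<1$ and $G(z)=\sum_{k\ge0}(1-z)^k\tilde G_k$ on $|z-1|<\min\{1,r-1\}$. Consider the system $y'(z)=\big(\frac1zA+\frac{1}{z-1}B+G(z)\big)y(z)$. Let $y_0(z)=z^{\alpha_0}h_0(z)$ be its solution on $\mathfrak{G}_0:=\mathfrak{D}\setminus[1,r[$ with $h_0$ holomorphic and $h_0(0)=a_0$, and let $$Y(z)=H(z)\begin{pmatrix}(1-z)^{\beta_1}&0\\0&(1-z)^{\beta_2}\end{pmatrix}\begin{pmatrix}1&0\\ q\log(1-z)&1\end{pmatrix}$$ be a fundamental matrix on $\mathfrak{G}_1:=\mathfrak{D}\setminus\,]-r,0]$, where $H$ is holomorphic on $\mathfrak{G}_1$ with $H(1)e_1=b_1$, $H(1)e_2=b_2$, and $q\in\mathbb{C}$ with $q=0$ if $\delta\notin\mathbb{Z}$. Define the connection coefficients $\Theta,\Omega$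 by $y_0(z)=Y(z)\binom{\Theta}{\Omega}$ on $\mathfrak{G}_0\cap\mathfrak{G}_1$. Let $d_k$ be defined by $(1-z)^{-\beta_1-1}h_0(z)=\sum_{k\ge0}z^kd_k$ for $|z|<1$, and let $\tilde d_k$ be defined by $(1-z)^{-\beta_1-1}z^{-\alpha_0}Y(z)e_2=(1-z)^{\delta-1}\sum_{k\ge0}(1-z)^k\tilde d_k$ near $z=1$ (so $\tilde d_0=b_2$). Then for any fixed integer $n\ge0$, $$d_k=\Theta b_1+\frac{\omega}{\Gamma(k+1)}\sum_{\ell=0}^n(-1)^\ell\,\Gamma(\ell+\delta)\,\Gamma(k-\ell+1-\delta)\,\tilde d_\ell+O\big(k^{-\operatorname{Re}(\delta)-n-1}\big)\quad\text{as }k\to\infty,$$ with some constant $\omega$ which is independent of $k$ and $n$.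
   Context: $e_1,e_2$ denote the standard basis of $\mathbb{C}^2$. Powers and logarithms are principal branches: $z^{\alpha}$ with $-\pi<\arg z<\pi$, $(1-z)^{\beta}$ and $\log(1-z)$ with $-\pi<\arg(1-z)<\pi$. $\Gamma$ is the Gamma function. *)

theory Defs
  imports "HOL-Complex_Analysis.Complex_Analysis" "HOL-Library.Landau_Symbols"
begin

definition mat_holomorphic_on :: "(complex \<Rightarrow> complex^2^2) \<Rightarrow> complex set \<Rightarrow> bool" where
  "mat_holomorphic_on M S \<longleftrightarrow> (\<forall>i j. (\<lambda>z. M z $ i $ j) holomorphic_on S)"

definition vec_holomorphic_on :: "(complex \<Rightarrow> complex^2) \<Rightarrow> complex set \<Rightarrow> bool" where
  "vec_holomorphic_on v S \<longleftrightarrow> (\<forall>i. (\<lambda>z. v z $ i) holomorphic_on S)"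

definition coef :: "complex^2^2 \<Rightarrow> complex^2^2 \<Rightarrow> (complex \<Rightarrow> complex^2^2) \<Rightarrow> complex \<Rightarrow> complex^2^2" where
  "coef A B G z = (\<chi> i j. A $ i $ j / z + B $ i $ j / (z - 1) + G z $ i $ j)"

definition solves_on :: "(complex \<Rightarrow> complex^2^2) \<Rightarrow> (complex \<Rightarrow> complex^2) \<Rightarrow> complex set \<Rightarrow> bool" where
  "solves_on M y S \<longleftrightarrow>
     (\<forall>z\<in>S. \<forall>i. ((\<lambda>w. y w $ i) has_field_derivative ((M z *v y z) $ i)) (at z))"

definition fundamental_matrix_on :: "(complex \<Rightarrow> complex^2^2) \<Rightarrow> (complex \<Rightarrow> complex^2^2) \<Rightarrow> complex set \<Rightarrow> bool" where
  "fundamental_matrix_on M Y S \<longleftrightarrow>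
     (\<forall>z\<in>S. \<forall>i j. ((\<lambda>w. Y w $ i $ j) has_field_derivative ((M z ** Y z) $ i $ j)) (at z))
     \<and> (\<forall>z\<in>S. det (Y z) \<noteq> 0)"

end

theory Submission
  imports Defs
begin

text \<open>
  The argument is Darboux's method. The function \<open>f(z) = (1 - z)\<^sup>-\<^sup>\<beta>\<^sup>1\<^sup>-\<^sup>1 h\<^sub>0(z)\<close>, whose Taylor
  coefficients are the \<open>d\<^sub>k\<close>, solves a linear system with holomorphic coefficients near every point of
  the unit circle except \<open>1\<close>; hence all its derivatives are bounded there. Near \<open>1\<close> the connection
  formula gives, with \<open>S(w) = \<Sum> w\<^sup>l dt\<^sub>l\<close> and \<open>v\<close> holomorphic,
  \<open>f(z) = \<Theta> b\<^sub>1 / (1 - z) + v(z) + (\<Theta> q log (1 - z) + \<Omega>) (1 - z)\<^sup>\<delta>\<^sup>-\<^sup>1 S(1 - z)\<close>.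
  Subtracting the pole and sufficiently many terms of the last summand leaves a function with bounded
  \<open>N\<close>-th derivative on the disc, whose coefficients are \<open>O(k\<^sup>-\<^sup>N)\<close> by Cauchy's inequality. The
  coefficients of the subtracted terms are explicit: by the reflection formula they are
  \<open>\<omega> (-1)\<^sup>l \<Gamma>(l + \<delta>) \<Gamma>(k - l + 1 - \<delta>) / k!\<close> with \<open>\<omega> = \<Omega> sin(\<pi>\<delta>) / \<pi>\<close> if \<open>\<delta>\<close> is not an integer. If it is,
  then \<open>\<delta> \<ge> 1\<close>, the \<open>\<Omega>\<close>-terms are polynomials, and the logarithmic terms give the same expression
  with \<open>\<omega> = (-1)\<^sup>\<delta> \<Theta> q\<close>.
\<close>

section \<open>Coefficient decay from a bounded derivative on the disc\<close>

lemma power_mult_fact_le_fact_add: "(n + 1) ^ N * fact n \<le> (fact (n + N) :: nat)"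
proof (induction N)
  case (Suc N)
  have "(n + 1) ^ Suc N * fact n = (n + 1) * ((n + 1) ^ N * fact n)" by (simp add: algebra_simps)
  also have "\<dots> \<le> (n + N + 1) * fact (n + N)" by (intro mult_mono Suc.IH) auto
  finally show ?case by (simp add: algebra_simps)
qed auto

text \<open>Each of the \<open>N\<close> factors left in the denominator is at least
  \<open>k / 2\<close>, because \<open>2 * N \<le> k\<close>. The lemma converts both Cauchy's
  inequality and the exact logarithmic coefficients into powers of \<open>k\<close>.\<close>

lemma fact_diff_div_fact_le:
  assumes "2 * N \<le> k" "k > 0"
  shows "fact (k - N) / fact k \<le> 2 ^ N * real k powr (- real N)"
proof -
  have "(real k / 2) ^ N * fact (k - N) \<le> real (k - N + 1) ^ N * fact (k - N)"
    by (intro mult_right_mono power_mono) (use assms in auto)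
  also have "\<dots> \<le> fact k"
  proof -
    have "k - N + N = k" using assms by simp
    hence "(k - N + 1) ^ N * fact (k - N) \<le> (fact k :: nat)"
      using power_mult_fact_le_fact_add[of "k - N" N] by simp
    hence "real ((k - N + 1) ^ N * fact (k - N)) \<le> real (fact k)" by (rule of_nat_mono)
    thus ?thesis by (simp only: of_nat_mult of_nat_power of_nat_fact)
  qed
  finally show ?thesis using assms by (simp add: powr_minus powr_realpow field_simps)
qed

text \<open>Cauchy's inequality for the \<open>k\<close>-th derivative of
  \<open>(deriv ^^ N) F\<close> on the circle of radius \<open>\<rho> < 1\<close>, followed by
  \<open>\<rho> \<longrightarrow> 1\<close>. Since \<open>K\<close> is uniform on the open disc, no
  extension of \<open>F\<close> to the boundary is required.\<close>

lemma power_series_coeff_le_of_bounded_higher_deriv: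
  fixes a :: "nat \<Rightarrow> complex"
  assumes sums: "\<And>z. norm z < 1 \<Longrightarrow> (\<lambda>k. a k * z ^ k) sums F z"
    and bdd: "\<And>z. norm z < 1 \<Longrightarrow> norm ((deriv ^^ N) F z) \<le> K"
  shows "norm (a (k + N)) * fact (k + N) \<le> K * fact k"
proof -
  have F: "F has_fps_expansion Abs_fps a"
    by (rule has_fps_expansionI, rule eventually_nhds_in_open[of "ball 0 1", THEN eventually_mono])
       (use sums in auto)
  have coeff: "a j = (deriv ^^ j) F 0 / fact j" for j
    using fps_nth_fps_expansion[OF F, of j] by simp
  have hol: "F holomorphic_on ball 0 1"
    by (rule power_series_holomorphic[of _ _ a]) (use sums in auto)
  have hol': "(deriv ^^ N) F holomorphic_on ball 0 1"
    by (rule holomorphic_higher_deriv[OF hol]) auto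
  have ineq: "norm ((deriv ^^ (k + N)) F 0) \<le> fact k * K / \<rho> ^ k" if "0 < \<rho>" "\<rho> < 1" for \<rho>
  proof -
    have "norm ((deriv ^^ k) ((deriv ^^ N) F) 0) \<le> fact k * K / \<rho> ^ k"
    proof (rule Cauchy_inequality)
      show "(deriv ^^ N) F holomorphic_on ball 0 \<rho>"
        by (rule holomorphic_on_subset[OF hol']) (use that in auto)
      show "continuous_on (cball 0 \<rho>) ((deriv ^^ N) F)"
        by (rule continuous_on_subset[OF holomorphic_on_imp_continuous_on[OF hol']]) (use that in auto)
    qed (use that bdd in auto)
    thus ?thesis by (simp add: funpow_add)
  qed
  have "((\<lambda>\<rho>. fact k * K / \<rho> ^ k) \<longlongrightarrow> fact k * K / 1 ^ k) (at_left (1::real))"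
    by (intro tendsto_intros) auto
  moreover have "eventually (\<lambda>\<rho>. norm ((deriv ^^ (k + N)) F 0) \<le> fact k * K / \<rho> ^ k) (at_left (1::real))"
    by (rule eventually_mono[OF eventually_at_left_real[of 0 "1::real"]]) (use ineq in auto)
  ultimately have "norm ((deriv ^^ (k + N)) F 0) \<le> fact k * K"
    by (intro tendsto_le[OF _ _ tendsto_const[of "norm ((deriv ^^ (k + N)) F 0)"]]) auto
  thus ?thesis unfolding coeff by (simp add: norm_divide mult_ac)
qed

lemma power_series_coeff_bigo_of_bounded_higher_deriv:
  fixes a :: "nat \<Rightarrow> complex"
  assumes sums: "\<And>z. norm z < 1 \<Longrightarrow> (\<lambda>k. a k * z ^ k) sums F z"
    and bdd: "\<And>z. norm z < 1 \<Longrightarrow> norm ((deriv ^^ N) F z) \<le> K"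
  shows "(\<lambda>k. norm (a k)) \<in> O(\<lambda>k. real k powr (- real N))"
proof (rule bigoI[of _ "K * 2 ^ N"])
  show "eventually (\<lambda>k. norm (norm (a k)) \<le> (K * 2 ^ N) * norm (real k powr (- real N))) at_top"
  proof (rule eventually_sequentiallyI[of "2 * N + 1"])
    fix k assume k: "2 * N + 1 \<le> k"
    have "norm ((deriv ^^ N) F 0) \<le> K" using bdd[of 0] by simp
    hence K0: "K \<ge> 0" by (rule order_trans[OF norm_ge_zero])
    have "norm (a k) \<le> K * (fact (k - N) / fact k)"
      using power_series_coeff_le_of_bounded_higher_deriv[OF sums bdd, of "k - N"] k
      by (simp add: field_simps)
    also have "\<dots> \<le> K * (2 ^ N * real k powr (- real N))"
      by (intro mult_left_mono fact_diff_div_fact_le K0) (use k in auto)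
    finally show "norm (norm (a k)) \<le> (K * 2 ^ N) * norm (real k powr (- real N))"
      by simp
  qed
qed

section \<open>From local bounds to global bounds\<close>

text \<open>Finitely many of the balls cover \<open>C\<close>, and the sum of the absolute values of
  their bounds dominates each one. The centres may lie on the boundary of \<open>U\<close>, as they
  do for the unit disc, while \<open>f\<close> is bounded only at points of
  \<open>U\<close>.\<close>

lemma bounded_of_locally_bounded_near_closure:
  fixes f :: "'a::metric_space \<Rightarrow> 'b::real_normed_vector"
  assumes comp: "compact C" and sub: "U \<subseteq> C"
    and loc: "\<And>c. c \<in> C \<Longrightarrow> \<exists>e>0. \<exists>K. \<forall>z\<in>U \<inter> ball c e. norm (f z) \<le> K"
  shows "\<exists>K. \<forall>z\<in>U. norm (f z) \<le> K"
proof -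
  from loc obtain e K where e: "\<And>c. c \<in> C \<Longrightarrow> e c > 0"
    and K: "\<And>c z. c \<in> C \<Longrightarrow> z \<in> U \<inter> ball c (e c) \<Longrightarrow> norm (f z) \<le> K c"
    by metis
  have "C \<subseteq> (\<Union>c\<in>C. ball c (e c))" using e by force
  then obtain T where T: "T \<subseteq> C" "finite T" "C \<subseteq> (\<Union>c\<in>T. ball c (e c))"
    using compactE_image[OF comp, of C "\<lambda>c. ball c (e c)"] by (metis open_ball)
  have "norm (f z) \<le> (\<Sum>c\<in>T. \<bar>K c\<bar>)" if z: "z \<in> U" for z
  proof -
    obtain c where c: "c \<in> T" "z \<in> ball c (e c)" using T z sub by blast
    have "norm (f z) \<le> \<bar>K c\<bar>" using K[of c z] c z T by force
    also have "\<dots> \<le> (\<Sum>c\<in>T. \<bar>K c\<bar>)" using c T by (intro member_le_sum) auto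
    finally show ?thesis .
  qed
  thus ?thesis by blast
qed

lemma holomorphic_bounded_on_half_ball:
  assumes "f holomorphic_on ball c e" "e > 0"
  shows "\<exists>K. \<forall>z\<in>ball c (e/2). norm (f z) \<le> K"
proof -
  have "continuous_on (cball c (e/2)) f"
    using assms by (intro continuous_on_subset[OF holomorphic_on_imp_continuous_on[OF assms(1)]]) auto
  hence "bounded (f ` cball c (e/2))"
    by (intro compact_imp_bounded compact_continuous_image) auto
  thus ?thesis by (force simp: bounded_iff)
qed

section \<open>Derivatives near the branch point\<close>

text \<open>As \<open>Re s \<ge> 1\<close>, a full factor \<open>norm w\<close> is available, and it
  absorbs the logarithm through \<open>ln x \<le> x - 1\<close> at \<open>x = 1 / norm w\<close>.
  The exponential comes from the argument of \<open>w\<close>, which is at most \<open>pi\<close> in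
  absolute value.\<close>

lemma norm_powr_mult_Ln_le:
  fixes w s :: complex
  assumes "w \<noteq> 0" "norm w \<le> 1" "Re s \<ge> 1"
  shows "norm (w powr s) \<le> exp (pi * \<bar>Im s\<bar>)" 
    and "norm (w powr s * Ln w) \<le> (1 + pi) * exp (pi * \<bar>Im s\<bar>)"
proof -
  have w0: "0 < norm w" using assms by simp
  have arg: "\<bar>Im (Ln w)\<bar> \<le> pi"
    using mpi_less_Im_Ln[of w] Im_Ln_le_pi[of w] assms by linarith
  have "- Im s * Arg w \<le> \<bar>Im s\<bar> * \<bar>Im (Ln w)\<bar>"
    using assms(1) by (metis Arg_eq_Im_Ln abs_ge_self abs_minus_cancel abs_mult)
  also have "\<dots> \<le> \<bar>Im s\<bar> * pi" using arg by (intro mult_left_mono) auto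
  finally have e: "exp (- Im s * Arg w) \<le> exp (pi * \<bar>Im s\<bar>)" by (simp add: mult.commute)
  have p: "norm w powr Re s \<le> norm w powr 1"
    by (rule powr_mono') (use assms in auto)
  hence b: "norm (w powr s) \<le> norm w * exp (pi * \<bar>Im s\<bar>)"
    unfolding norm_powr_complex by (intro mult_mono e) (use w0 in auto)
  also have "\<dots> \<le> 1 * exp (pi * \<bar>Im s\<bar>)" by (intro mult_right_mono) (use assms in auto)
  finally show "norm (w powr s) \<le> exp (pi * \<bar>Im s\<bar>)" by simp
  have "norm (Ln w) \<le> \<bar>Re (Ln w)\<bar> + \<bar>Im (Ln w)\<bar>" by (rule cmod_le)
  also have "\<bar>Re (Ln w)\<bar> = ln (1 / norm w)"
    using assms w0 by (simp add: Re_Ln ln_div)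
  also have "\<dots> \<le> 1 / norm w - 1" using w0 by (intro ln_le_minus_one) auto
  finally have "norm (Ln w) \<le> 1 / norm w + pi" using arg by linarith
  hence "norm w * norm (Ln w) \<le> norm w * (1 / norm w + pi)" using w0 by (intro mult_left_mono) auto
  also have "\<dots> = 1 + norm w * pi" using w0 by (simp add: field_simps)
  also have "\<dots> \<le> 1 + pi" using assms by simp
  finally have l: "norm w * norm (Ln w) \<le> 1 + pi" .
  have "norm (w powr s * Ln w) \<le> (norm w * exp (pi * \<bar>Im s\<bar>)) * norm (Ln w)"
    unfolding norm_mult by (intro mult_right_mono b) auto
  also have "\<dots> = (norm w * norm (Ln w)) * exp (pi * \<bar>Im s\<bar>)" by simp
  also have "\<dots> \<le> (1 + pi) * exp (pi * \<bar>Im s\<bar>)" by (intro mult_right_mono l) auto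
  finally show "norm (w powr s * Ln w) \<le> (1 + pi) * exp (pi * \<bar>Im s\<bar>)" .
qed

lemma one_minus_notin_nonpos_Reals: "norm (z::complex) < 1 \<Longrightarrow> 1 - z \<notin> \<real>\<^sub>\<le>\<^sub>0"
  using complex_Re_le_cmod[of z] by (auto simp: complex_nonpos_Reals_iff)

text \<open>Functions of the form \<open>(1 - z) powr s * (g1 z + Ln (1 - z) * g2 z)\<close> are
  closed under differentiation, at the cost of lowering \<open>s\<close> by one. After
  \<open>N\<close> derivatives the exponent still has real part at least 1, so the product with the
  logarithm is bounded.\<close>

lemma higher_deriv_bounded_near_branch_point:
  fixes F g1 g2 :: "complex \<Rightarrow> complex"
  assumes "0 < e" "e \<le> 1" "F holomorphic_on ball 0 1 \<inter> ball 1 e"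
    and "g1 holomorphic_on ball 1 e" "g2 holomorphic_on ball 1 e"
    and "\<And>z. z \<in> ball 0 1 \<inter> ball 1 e \<Longrightarrow> F z = (1 - z) powr s * (g1 z + Ln (1 - z) * g2 z)"
    and "Re s \<ge> real N + 1"
  shows "\<exists>K. \<forall>z\<in>ball 0 1 \<inter> ball 1 (e/2). norm ((deriv ^^ N) F z) \<le> K"
  using assms(3-)
proof (induction N arbitrary: F g1 g2 s)
  case 0
  obtain K1 where K1: "\<And>z. z\<in>ball 1 (e/2) \<Longrightarrow> norm (g1 z) \<le> K1"
    using holomorphic_bounded_on_half_ball[OF 0(2) \<open>0 < e\<close>] by blast
  obtain K2 where K2: "\<And>z. z\<in>ball 1 (e/2) \<Longrightarrow> norm (g2 z) \<le> K2"
    using holomorphic_bounded_on_half_ball[OF 0(3) \<open>0 < e\<close>] by blast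
  let ?E = "exp (pi * \<bar>Im s\<bar>)"
  have "norm (F z) \<le> ?E * K1 + (1 + pi) * ?E * K2" if z: "z \<in> ball 0 1 \<inter> ball 1 (e/2)" for z
  proof -
    have d: "dist 1 z < e" "dist 1 z \<le> 1"
      using z \<open>0 < e\<close> \<open>e \<le> 1\<close> zero_le_dist[of 1 z] unfolding Int_iff mem_ball by linarith+
    have z': "z \<in> ball 0 1 \<inter> ball 1 e" using z d by auto
    have nz: "1 - z \<noteq> 0" "norm (1 - z) \<le> 1" using z d by (auto simp: dist_norm)
    have "F z = (1 - z) powr s * g1 z + ((1 - z) powr s * Ln (1 - z)) * g2 z"
      using 0(4)[OF z'] by (simp add: algebra_simps)
    also have "norm \<dots> \<le> ?E * K1 + (1 + pi) * ?E * K2"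
      by (rule order_trans[OF norm_triangle_ineq], subst (1 2) norm_mult, intro add_mono mult_mono)
         (use K1 K2 z norm_powr_mult_Ln_le[OF nz, of s] 0(5) in \<open>auto\<close>)
    finally show ?thesis .
  qed
  thus ?case unfolding funpow_0 by blast
next
  case (Suc N)
  \<comment> \<open>\<open>h1\<close> and \<open>h2\<close> are what the product rule leaves after
    \<open>(1 - z) powr (s - 1)\<close> is factored out; the term \<open>- g2 z\<close> is the
    derivative of the logarithm.\<close>
  define h1 where "h1 = (\<lambda>z. (1 - z) * deriv g1 z - s * g1 z - g2 z)"
  define h2 where "h2 = (\<lambda>z. (1 - z) * deriv g2 z - s * g2 z)"
  have "\<exists>K. \<forall>z\<in>ball 0 1 \<inter> ball 1 (e/2). norm ((deriv ^^ N) (deriv F) z) \<le> K"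
  proof (rule Suc.IH[of _ h1 h2 "s - 1"])
    show "deriv F holomorphic_on ball 0 1 \<inter> ball 1 e"
      by (intro holomorphic_deriv Suc.prems) auto
    show "h1 holomorphic_on ball 1 e" "h2 holomorphic_on ball 1 e"
      unfolding h1_def h2_def by (intro holomorphic_intros Suc.prems holomorphic_deriv open_ball)+
    show "Re (s - 1) \<ge> real N + 1" using Suc.prems by simp
    fix z :: complex assume z: "z \<in> ball 0 1 \<inter> ball 1 e"
    have np: "1 - z \<notin> \<real>\<^sub>\<le>\<^sub>0" using z one_minus_notin_nonpos_Reals by auto
    hence nz: "1 - z \<noteq> 0" by auto
    have [derivative_intros]: "(g1 has_field_derivative deriv g1 z) (at z)"
        "(g2 has_field_derivative deriv g2 z) (at z)"
      using holomorphic_derivI[OF Suc.prems(2), of z] holomorphic_derivI[OF Suc.prems(3), of z] z by auto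
    have "((\<lambda>z. (1 - z) powr s * (g1 z + Ln (1 - z) * g2 z)) has_field_derivative
             (1 - z) powr (s - 1) * (h1 z + Ln (1 - z) * h2 z)) (at z)"
    proof -
      have P: "(1 - z) powr s = (1 - z) * (1 - z) powr (s - 1)"
        using nz by (simp add: powr_diff)
      have "((\<lambda>z. (1 - z) powr s * (g1 z + Ln (1 - z) * g2 z)) has_field_derivative
          (s * (1 - z) powr (s - 1) * (-1)) * (g1 z + Ln (1 - z) * g2 z) +
          (deriv g1 z + (inverse (1 - z) * (-1) * g2 z + deriv g2 z * Ln (1 - z))) * (1 - z) powr s) (at z)"
        by (rule derivative_eq_intros refl np | simp add: inverse_eq_divide)+
      also have "(s * (1 - z) powr (s - 1) * (-1)) * (g1 z + Ln (1 - z) * g2 z) +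
          (deriv g1 z + (inverse (1 - z) * (-1) * g2 z + deriv g2 z * Ln (1 - z))) * (1 - z) powr s
          = (1 - z) powr (s - 1) * ((1 - z) * deriv g1 z - s * g1 z - (inverse (1 - z) * (1 - z)) * g2 z
              + Ln (1 - z) * h2 z)"
        unfolding P h2_def by algebra
      also have "\<dots> = (1 - z) powr (s - 1) * (h1 z + Ln (1 - z) * h2 z)"
        using nz by (simp add: h1_def)
      finally show ?thesis .
    qed
    hence "(F has_field_derivative (1 - z) powr (s - 1) * (h1 z + Ln (1 - z) * h2 z)) (at z)"
      by (rule has_field_derivative_transform_within_open[of _ _ _ "ball 0 1 \<inter> ball 1 e"])
         (use z Suc.prems(4) in auto)
    thus "deriv F z = (1 - z) powr (s - 1) * (h1 z + Ln (1 - z) * h2 z)" by (rule DERIV_imp_deriv)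
  qed
  thus ?case by (simp add: funpow_swap1)
qed

section \<open>Regular points of the unit circle\<close>

text \<open>
  In place of Gronwall's inequality: on a segment so short that the derivative bound times the
  length is at most \<open>1/2\<close>, the maximum of \<open>\<Sum>|f\<^sub>i|\<close> is at most twice its initial value.
\<close>
lemma linear_ode_bounded_near_regular_point:
  fixes f :: "'i::finite \<Rightarrow> complex \<Rightarrow> complex" and m :: "'i \<Rightarrow> 'i \<Rightarrow> complex \<Rightarrow> complex"
  assumes V: "convex V" "V \<subseteq> ball c e" and e: "e > 0"
    and m: "\<And>i j. m i j holomorphic_on ball c e"
    and ode: "\<And>i z. z \<in> V \<Longrightarrow> (f i has_field_derivative (\<Sum>j\<in>UNIV. m i j z * f j z)) (at z)"
  shows "\<exists>e'>0. e' \<le> e \<and> (\<exists>K. \<forall>z\<in>V \<inter> ball c e'. \<forall>i. norm (f i z) \<le> K)"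
proof -
  have "\<exists>K. \<forall>z\<in>ball c (e/2). norm (m i j z) \<le> K" for i j
    using holomorphic_bounded_on_half_ball[OF m e] by blast
  then obtain K where K: "\<And>i j z. z \<in> ball c (e/2) \<Longrightarrow> norm (m i j z) \<le> K i j" by metis
  define M where "M = (\<Sum>i\<in>UNIV. \<Sum>j\<in>UNIV. \<bar>K i j\<bar>)"
  have M: "norm (m i j z) \<le> M" if "z \<in> ball c (e/2)" for i j z
  proof -
    have "norm (m i j z) \<le> \<bar>K i j\<bar>" using K[OF that, of i j] by linarith
    also have "\<dots> \<le> (\<Sum>j\<in>UNIV. \<bar>K i j\<bar>)" by (intro member_le_sum) auto
    also have "\<dots> \<le> M" unfolding M_def
      by (intro member_le_sum[of i UNIV "\<lambda>i. \<Sum>j\<in>UNIV. \<bar>K i j\<bar>"] sum_nonneg) auto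
    finally show ?thesis .
  qed
  have M0: "M \<ge> 0" unfolding M_def by (intro sum_nonneg) auto
  define n where "n = real CARD('i)"
  have n0: "n > 0" unfolding n_def by simp
  \<comment> \<open>The bound \<open>M\<close> is known only on the ball of radius
    \<open>e / 2\<close>. The second entry makes \<open>n * M\<close> times the diameter
    \<open>2 * e'\<close> at most 1/2, and \<open>M + 1\<close> avoids division by zero.\<close>
  define e' where "e' = min (e/2) (1 / (4 * n * (M + 1)))"
  have e': "e' > 0" "e' \<le> e/2" "e' \<le> 1 / (4 * n * (M + 1))" 
    using e M0 n0 by (auto simp: e'_def)
  have small: "n * (M * (2 * e')) \<le> 1/2"
  proof -
    have "n * (M * (2 * e')) \<le> n * ((M + 1) * (2 * e'))"
      using M0 n0 e' by (intro mult_left_mono mult_right_mono) auto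
    also have "\<dots> \<le> n * ((M + 1) * (2 * (1 / (4 * n * (M + 1)))))"
      using M0 n0 e' by (intro mult_left_mono) auto
    also have "\<dots> = (n * (M + 1)) / (2 * (n * (M + 1)))" by simp
    also have "\<dots> = 1/2" using M0 n0 by (subst divide_divide_eq_left[symmetric]) simp
    finally show ?thesis .
  qed
  define P where "P = (\<lambda>w. \<Sum>i\<in>UNIV. norm (f i w))"
  have Pge: "norm (f i w) \<le> P w" for i w unfolding P_def by (intro member_le_sum) auto
  define W where "W = V \<inter> ball c e'"
  have W: "convex W" unfolding W_def by (intro convex_Int V convex_ball)
  show ?thesis
  proof (cases "W = {}")
    case True
    thus ?thesis using e' e unfolding W_def by (intro exI[of _ e']) auto
  next
    case False
    then obtain z0 where z0: "z0 \<in> W" by blast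
    have "norm (f i z) \<le> 2 * P z0" if z: "z \<in> W" for z i
    proof -
      define L where "L = closed_segment z0 z"
      have L: "L \<subseteq> W" unfolding L_def using W z z0 by (simp add: closed_segment_subset)
      have contP: "continuous_on L P" unfolding P_def
        by (intro continuous_intros continuous_at_imp_continuous_on ballI DERIV_isCont[OF ode])
           (use L W_def in auto)
      obtain x where x: "x \<in> L" "\<And>y. y \<in> L \<Longrightarrow> P y \<le> P x"
        using continuous_attains_sup[OF _ _ contP] unfolding L_def by auto
      have "norm (f i x) \<le> norm (f i z0) + M * P x * (2 * e')" for i
      proof -
        have "norm (f i x - f i z0) \<le> (M * P x) * norm (x - z0)"
        proof (rule field_differentiable_bound[of L])
          fix w assume w: "w \<in> L"
          have wV: "w \<in> V" "w \<in> ball c (e/2)" using w L e' unfolding W_def by auto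
          show "(f i has_field_derivative (\<Sum>j\<in>UNIV. m i j w * f j w)) (at w within L)"
            by (rule has_field_derivative_at_within[OF ode[OF wV(1)]])
          have "norm (\<Sum>j\<in>UNIV. m i j w * f j w) \<le> (\<Sum>j\<in>UNIV. M * norm (f j w))"
            by (rule sum_norm_le) (use M[OF wV(2)] in \<open>auto simp: norm_mult intro!: mult_right_mono\<close>)
          also have "\<dots> = M * P w" by (simp add: P_def sum_distrib_left)
          also have "\<dots> \<le> M * P x" by (intro mult_left_mono x w M0)
          finally show "norm (\<Sum>j\<in>UNIV. m i j w * f j w) \<le> M * P x" .
        qed (use x L_def in auto)
        also have "\<dots> \<le> (M * P x) * (2 * e')"
        proof (intro mult_left_mono)
          have "dist x z0 \<le> dist c x + dist c z0" by (metis dist_commute dist_triangle)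
          also have "\<dots> \<le> 2 * e'" using x(1) L z0 unfolding W_def by force
          finally show "norm (x - z0) \<le> 2 * e'" by (simp add: dist_norm)
          show "0 \<le> M * P x" using M0 by (auto simp: P_def intro!: mult_nonneg_nonneg sum_nonneg)
        qed
        finally show ?thesis using norm_triangle_ineq2[of "f i x" "f i z0"] by linarith
      qed
      hence "P x \<le> (\<Sum>i\<in>(UNIV::'i set). norm (f i z0) + M * P x * (2 * e'))"
        unfolding P_def by (intro sum_mono) auto
      also have "\<dots> = P z0 + (n * (M * (2 * e'))) * P x"
        by (simp add: sum.distrib P_def n_def)
      also have "\<dots> \<le> P z0 + 1/2 * P x"
        by (intro add_left_mono mult_right_mono small) (auto simp: P_def intro!: sum_nonneg)
      finally have "P x \<le> 2 * P z0" by simp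
      moreover have "P z \<le> P x" using x(2)[of z] by (simp add: L_def)
      ultimately show ?thesis using Pge[of i z] by linarith
    qed
    hence "\<exists>K. \<forall>z\<in>V \<inter> ball c e'. \<forall>i. norm (f i z) \<le> K" unfolding W_def by blast
    thus ?thesis using e' e by (intro exI[of _ e']) auto
  qed
qed

text \<open>Differentiating a combination of the \<open>f i\<close> with holomorphic coefficients
  and inserting the system gives another such combination. Boundedness of the \<open>f i\<close>
  themselves therefore passes to all derivatives.\<close>

lemma higher_deriv_bounded_near_regular_point:
  fixes f :: "'i::finite \<Rightarrow> complex \<Rightarrow> complex" and m :: "'i \<Rightarrow> 'i \<Rightarrow> complex \<Rightarrow> complex"
  assumes V: "convex V" "open V" "V \<subseteq> ball c e" and e: "e > 0"
    and m: "\<And>i j. m i j holomorphic_on ball c e"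
    and ode: "\<And>i z. z \<in> V \<Longrightarrow> (f i has_field_derivative (\<Sum>j\<in>UNIV. m i j z * f j z)) (at z)"
  shows "\<exists>e'>0. \<exists>K. \<forall>z\<in>V \<inter> ball c e'. norm ((deriv ^^ N) (f i) z) \<le> K"
proof -
  obtain e1 K1 where e1: "e1 > 0" "e1 \<le> e"
    and K1: "\<And>z i. z \<in> V \<inter> ball c e1 \<Longrightarrow> norm (f i z) \<le> K1"
    using linear_ode_bounded_near_regular_point[OF V(1,3) e m ode] by blast
  \<comment> \<open>The claim is generalised from \<open>f i\<close> to arbitrary combinations so
    that the induction on \<open>N\<close> closes; \<open>f i\<close> is recovered at the end with
    Kronecker coefficients.\<close>
  have comb: "\<exists>K. \<forall>z\<in>V \<inter> ball c (e1/2). norm ((deriv ^^ N) F z) \<le> K"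
    if "\<And>i. g i holomorphic_on ball c e" "F holomorphic_on V"
       "\<And>z. z \<in> V \<Longrightarrow> F z = (\<Sum>i\<in>UNIV. g i z * f i z)" for F and g :: "'i \<Rightarrow> complex \<Rightarrow> complex"
    using that
  proof (induction N arbitrary: F g)
    case 0
    have "g i holomorphic_on ball c e1" for i
      using e1 by (intro holomorphic_on_subset[OF 0(1)]) auto
    hence "\<exists>K. \<forall>z\<in>ball c (e1/2). norm (g i z) \<le> K" for i
      using e1 by (intro holomorphic_bounded_on_half_ball)
    then obtain K where K: "\<And>i z. z \<in> ball c (e1/2) \<Longrightarrow> norm (g i z) \<le> K i" by metis
    have "norm (F z) \<le> (\<Sum>i\<in>UNIV. K i * K1)" if z: "z \<in> V \<inter> ball c (e1/2)" for z
    proof -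
      have z1: "z \<in> V \<inter> ball c e1" using z e1 by auto
      have "norm (g i z * f i z) \<le> K i * K1" for i
        unfolding norm_mult using K[of z i] K1[OF z1, of i] z
        by (intro mult_mono order_trans[OF norm_ge_zero K[of z i]]) auto
      thus ?thesis using 0(3)[of z] z by (auto intro: sum_norm_le)
    qed
    thus ?case unfolding funpow_0 by blast
  next
    case (Suc N)
    define h where "h = (\<lambda>j z. deriv (g j) z + (\<Sum>i\<in>UNIV. g i z * m i j z))"
    have "\<exists>K. \<forall>z\<in>V \<inter> ball c (e1/2). norm ((deriv ^^ N) (deriv F) z) \<le> K"
    proof (rule Suc.IH[of h])
      show "h i holomorphic_on ball c e" for i
        unfolding h_def by (intro holomorphic_intros Suc.prems m holomorphic_deriv open_ball)
      show "deriv F holomorphic_on V" by (intro holomorphic_deriv Suc.prems V)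
      fix z assume z: "z \<in> V"
      have g: "(g i has_field_derivative deriv (g i) z) (at z)" for i
        using holomorphic_derivI[OF Suc.prems(1), of z] z V by auto
      have "((\<lambda>z. \<Sum>i\<in>UNIV. g i z * f i z) has_field_derivative
          (\<Sum>i\<in>UNIV. deriv (g i) z * f i z + (\<Sum>j\<in>UNIV. m i j z * f j z) * g i z)) (at z)"
        by (intro DERIV_sum DERIV_mult g ode z)
      hence "(F has_field_derivative
          (\<Sum>i\<in>UNIV. deriv (g i) z * f i z + (\<Sum>j\<in>UNIV. m i j z * f j z) * g i z)) (at z)"
        by (rule has_field_derivative_transform_within_open[of _ _ _ V]) (use z V Suc.prems in auto)
      hence "deriv F z = (\<Sum>i\<in>UNIV. deriv (g i) z * f i z + (\<Sum>j\<in>UNIV. m i j z * f j z) * g i z)"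
        by (rule DERIV_imp_deriv)
      also have "\<dots> = (\<Sum>i\<in>UNIV. deriv (g i) z * f i z) + (\<Sum>i\<in>UNIV. \<Sum>j\<in>UNIV. g i z * m i j z * f j z)"
        by (simp add: sum.distrib sum_distrib_left mult_ac)
      also have "(\<Sum>i\<in>UNIV. \<Sum>j\<in>UNIV. g i z * m i j z * f j z) = (\<Sum>j\<in>UNIV. (\<Sum>i\<in>UNIV. g i z * m i j z) * f j z)"
        by (subst sum.swap) (simp add: sum_distrib_right)
      finally show "deriv F z = (\<Sum>j\<in>UNIV. h j z * f j z)"
        by (simp add: h_def sum.distrib ring_distribs)
    qed
    thus ?case by (simp add: funpow_swap1)
  qed
  have "\<exists>K. \<forall>z\<in>V \<inter> ball c (e1/2). norm ((deriv ^^ N) (f i) z) \<le> K"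
  proof (rule comb[of "\<lambda>j z. if j = i then 1 else 0"])
    show "f i holomorphic_on V"
      using ode V by (auto simp: holomorphic_on_open)
  qed (auto simp: if_distrib[of "\<lambda>x. x * _"] cong: if_cong)
  thus ?thesis using e1 by (intro exI[of _ "e1/2"]) auto
qed

section \<open>Taylor coefficients of the singular terms\<close>

lemma sums_power_series_mult_one_minus:
  fixes a :: "nat \<Rightarrow> complex"
  assumes "(\<lambda>k. a k * z ^ k) sums s"
  shows "(\<lambda>k. (a k - (if k = 0 then 0 else a (k - 1))) * z ^ k) sums ((1 - z) * s)"
proof -
  have "(\<lambda>k. (if k = 0 then 0 else a (k - 1)) * z ^ k) sums (z * s)"
    using sums_Suc[of "\<lambda>k. (if k = 0 then 0 else a (k - 1)) * z ^ k" "z * s"]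
      sums_mult[OF assms, of z] by (simp add: mult_ac)
  from sums_diff[OF assms this] show ?thesis by (simp add: algebra_simps)
qed

text \<open>Multiplication by \<open>1 - z\<close> takes backward differences of the coefficients,
  and the closed form is stable under this step. It holds only beyond index
  \<open>p\<close>.\<close>

lemma power_series_Ln_mult_power:
  "\<exists>c. (\<forall>z. norm z < 1 \<longrightarrow> (\<lambda>k. c k * z ^ k) sums (Ln (1 - z) * (1 - z) ^ p)) \<and>
       (\<forall>k>p. c k = - ((-1) ^ p * fact p * fact (k - p - 1) / fact k))"
proof (induction p)
  case 0
  \<comment> \<open>At \<open>k = 0\<close> the coefficient is \<open>- 1 / 0 = 0\<close>, which
    matches the missing constant term of the logarithmic series.\<close>
  have "(\<lambda>k. (- 1 / of_nat k) * z ^ k) sums (Ln (1 - z) * (1 - z) ^ 0)" if "norm z < 1" for z :: complex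
    using Ln_series'[of "-z"] that by simp
  moreover have "- 1 / of_nat k = - ((-1) ^ 0 * fact 0 * fact (k - 0 - 1) / (fact k :: complex))" if "k > 0" for k
    using that by (cases k) (auto simp: divide_simps)
  ultimately show ?case by (intro exI[of _ "\<lambda>k. - 1 / of_nat k"]) blast
next
  case (Suc p)
  then obtain c where c: "\<And>z. norm z < 1 \<Longrightarrow> (\<lambda>k. c k * z ^ k) sums (Ln (1 - z) * (1 - z) ^ p)"
     "\<And>k. k > p \<Longrightarrow> c k = - ((-1) ^ p * fact p * fact (k - p - 1) / fact k)" by blast
  have "(\<lambda>k. (c k - (if k = 0 then 0 else c (k - 1))) * z ^ k) sums (Ln (1 - z) * (1 - z) ^ Suc p)"
    if "norm z < 1" for z :: complex
    using sums_power_series_mult_one_minus[OF c(1)[OF that]] by (simp add: algebra_simps)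
  moreover have "c k - (if k = 0 then 0 else c (k - 1)) =
      - ((-1) ^ Suc p * fact (Suc p) * fact (k - Suc p - 1) / fact k)" if "k > Suc p" for k
  proof -
    \<comment> \<open>The shift removes truncated subtraction: the factorials at \<open>k\<close>
      and \<open>k - 1\<close> become those of \<open>j + 1\<close> and \<open>j\<close>.\<close>
    define j where "j = k - (p + 2)"
    have k: "k = j + p + 2" using that by (simp add: j_def)
    have "(fact (j + p + 2) :: complex) = of_nat (j + p + 2) * fact (j + p + 1)"
      using fact_Suc[of "j + p + 1"] by simp
    moreover have "(fact (j + 1) :: complex) = of_nat (j + 1) * fact j" by simp
    ultimately have "c k - c (k - 1) = - ((-1) ^ p * fact p * fact j * (of_nat (j + 1) / (of_nat (j + p + 2) * fact (j + p + 1)) - 1 / fact (j + p + 1)))"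
      unfolding k using c(2)[of "j + p + 2"] c(2)[of "j + p + 1"] by (simp add: algebra_simps del: fact_Suc)
    also have "of_nat (j + 1) / (of_nat (j + p + 2) * fact (j + p + 1)) - 1 / fact (j + p + 1)
        = (- of_nat (Suc p) / fact (j + p + 2) :: complex)"
    proof -
      have "of_nat (j + p + 2) \<noteq> (0::complex)" by (subst of_nat_eq_0_iff) simp
      thus ?thesis unfolding \<open>fact (j + p + 2) = _\<close>
        by (simp add: divide_simps del: fact_Suc)
    qed
    finally show ?thesis unfolding k by (simp del: fact_Suc of_nat_Suc add: fact_Suc[of p] mult_ac)
  qed
  ultimately show ?case
    by (intro exI[of _ "\<lambda>k. c k - (if k = 0 then 0 else c (k - 1))"] conjI allI impI)
qed

text \<open>With \<open>x = l + \<delta>\<close> the left side is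
  \<open>pochhammer (1 - x) k / fact k\<close>, a quotient of Gamma values. The reflection formula
  replaces \<open>1 / Gamma (1 - x)\<close> by \<open>Gamma x * sin (pi * x) / pi\<close>, and the
  sine contributes \<open>l\<close> only through its sign. The remaining prefactor is free of
  \<open>l\<close>.\<close>

lemma gbinomial_Gamma_reflection:
  fixes \<delta> :: complex
  assumes "\<delta> \<notin> \<int>"
  shows "(-1) ^ k * ((\<delta> - 1 + of_nat l) gchoose k) = (sin (of_real pi * \<delta>) / of_real pi) / Gamma (of_nat k + 1)
           * ((-1) ^ l * Gamma (of_nat l + \<delta>) * Gamma (of_nat k - of_nat l + 1 - \<delta>))"
proof -
  define x where "x = of_nat l + \<delta>"
  have xZ: "x \<notin> \<int>" using assms unfolding x_def by (metis Ints_diff Ints_of_nat add_diff_cancel_left')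
  hence x1Z: "1 - x \<notin> \<int>" by (metis Ints_1 Ints_diff diff_diff_eq2 add_diff_cancel_left')
  hence np: "1 - x \<notin> \<int>\<^sub>\<le>\<^sub>0" using nonpos_Ints_Int by blast
  have sx: "sin (of_real pi * x) = (-1) ^ l * sin (of_real pi * \<delta>)"
  proof (unfold x_def, induction l)
    case (Suc l)
    have "sin (of_real pi * (of_nat (Suc l) + \<delta>)) = sin (of_real pi * (of_nat l + \<delta>) + of_real pi)"
      by (simp add: algebra_simps)
    also have "\<dots> = - sin (of_real pi * (of_nat l + \<delta>))"
      by (simp add: sin_add sin_of_real cos_of_real)
    finally show ?case using Suc.IH by simp
  qed simp
  have G0: "Gamma (1 - x) \<noteq> 0" using np by (simp add: Gamma_eq_zero_iff)
  have refl: "Gamma x * Gamma (1 - x) = of_real pi / sin (of_real pi * x)"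
    by (rule Gamma_reflection_complex)
  have G1: "Gamma x \<noteq> 0" using xZ nonpos_Ints_Int by (auto simp: Gamma_eq_zero_iff)
  have s0: "sin (of_real pi * x) \<noteq> 0" using refl G0 G1 by auto
  have inv: "1 / Gamma (1 - x) = (-1) ^ l * sin (of_real pi * \<delta>) * Gamma x / of_real pi"
    using refl G0 s0 unfolding sx by (simp add: field_simps)
  have "(-1) ^ k * ((\<delta> - 1 + of_nat l) gchoose k) = pochhammer (1 - x) k / fact k"
    unfolding gbinomial_pochhammer by (simp add: x_def algebra_simps flip: power_mult_distrib)
  also have "\<dots> = Gamma (1 - x + of_nat k) * (1 / Gamma (1 - x)) / fact k"
    using pochhammer_Gamma[OF np] by simp
  also have "fact k = Gamma (of_nat k + 1 :: complex)" by (simp add: Gamma_fact add.commute)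
  finally show ?thesis unfolding inv by (simp add: x_def algebra_simps)
qed

text \<open>The limit \<open>inverse (Gamma (- s))\<close> of the quotient is zero for nonnegative
  integers \<open>s\<close>, so only an upper bound results.\<close>

lemma norm_gbinomial_bigo:
  fixes s :: complex
  shows "(\<lambda>k. norm (s gchoose k)) \<in> O(\<lambda>k. real k powr (- Re s - 1))"
proof (rule bigoI_tendsto_norm)
  have "(\<lambda>n. norm ((s gchoose n) / ((-1)^n / exp ((s+1) * of_real (ln (real n)))))) \<longlonglongrightarrow> norm (inverse (Gamma (- s)))"
    by (intro tendsto_norm gbinomial_asymptotic)
  moreover have "eventually (\<lambda>n. norm ((s gchoose n) / ((-1)^n / exp ((s+1) * of_real (ln (real n))))) =
      norm (norm (s gchoose n) / (real n powr (- Re s - 1)))) sequentially"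
    using eventually_gt_at_top[of "0::nat"]
    by eventually_elim (simp add: norm_divide norm_mult norm_power powr_def exp_minus[symmetric] divide_simps mult.assoc flip: exp_add, simp add: algebra_simps exp_diff exp_minus exp_add)
  ultimately show "(\<lambda>n. norm (norm (s gchoose n) / (real n powr (- Re s - 1)))) \<longlonglongrightarrow> norm (inverse (Gamma (- s)))"
    by (rule Lim_transform_eventually)
  show "\<forall>\<^sub>F k in sequentially. real k powr (- Re s - 1) \<noteq> 0"
    using eventually_gt_at_top[of "0::nat"] by eventually_elim auto
qed

text \<open>The order of quantifiers matters: one \<open>\<omega>\<close> for all \<open>l\<close>
  is what makes the final constant independent of \<open>n\<close>. The Gamma formula is asserted
  only for large \<open>k\<close>, because for integer \<open>\<delta>\<close> the small indices
  meet poles of Gamma and a polynomial contribution from \<open>\<Omega>\<close>.\<close>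

lemma singular_term_coeffs:
  fixes \<delta> q \<Omega> :: complex
  assumes "\<delta> \<noteq> 0" "Re \<delta> > -1" and q: "\<delta> \<notin> \<int> \<Longrightarrow> q = 0"
  shows "\<exists>\<omega>. \<forall>l. \<exists>c.
    (\<forall>z. norm z < 1 \<longrightarrow> (\<lambda>k. c k * z ^ k) sums ((q * Ln (1 - z) + \<Omega>) * (1 - z) powr (\<delta> - 1 + of_nat l))) \<and>
    (\<forall>\<^sub>F k in sequentially. c k = \<omega> / Gamma (of_nat k + 1) *
       ((-1) ^ l * Gamma (of_nat l + \<delta>) * Gamma (of_nat k - of_nat l + 1 - \<delta>))) \<and>
    (\<lambda>k. norm (c k)) \<in> O(\<lambda>k. real k powr (- Re \<delta> - real l))"
proof (cases "\<delta> \<in> \<int>")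
  case False
  show ?thesis
  proof (intro exI allI conjI impI)
    fix l :: nat
    \<comment> \<open>The logarithm is absent since \<open>q = 0\<close>, so these are binomial
      coefficients. The outer witness is still schematic here; it becomes
      \<open>\<Omega> * sin (pi * \<delta>) / pi\<close>, which cannot depend on
      \<open>l\<close>.\<close>
    let ?c = "\<lambda>k. \<Omega> * ((-1) ^ k * ((\<delta> - 1 + of_nat l) gchoose k))"
    show "(\<lambda>k. ?c k * z ^ k) sums ((q * Ln (1 - z) + \<Omega>) * (1 - z) powr (\<delta> - 1 + of_nat l))"
      if "norm z < 1" for z
      using sums_mult[OF gen_binomial_complex[of "-z" "\<delta> - 1 + of_nat l"], of \<Omega>] that q[OF False]
      by (simp add: power_minus' mult_ac power_minus[of z])
    show "\<forall>\<^sub>F k in sequentially. ?c k = (\<Omega> * sin (of_real pi * \<delta>) / of_real pi) / Gamma (of_nat k + 1) *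
       ((-1) ^ l * Gamma (of_nat l + \<delta>) * Gamma (of_nat k - of_nat l + 1 - \<delta>))"
      unfolding gbinomial_Gamma_reflection[OF False] by simp
    have "(\<lambda>k. norm ((\<delta> - 1 + of_nat l) gchoose k)) \<in> O(\<lambda>k. real k powr (- Re \<delta> - real l))"
      using norm_gbinomial_bigo[of "\<delta> - 1 + of_nat l"] by (simp add: algebra_simps)
    thus "(\<lambda>k. norm (?c k)) \<in> O(\<lambda>k. real k powr (- Re \<delta> - real l))"
      by (simp add: norm_mult norm_power)
  qed
next
  case True
  then obtain i where i: "\<delta> = of_int i" by (auto elim: Ints_cases)
  with assms have "i \<ge> 1" by auto
  then obtain p0 where p0: "i = int p0 + 1" using zle_iff_zadd[of 1 i] by auto
  have \<delta>: "\<delta> = of_nat p0 + 1" using i p0 by simp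
  show ?thesis
  \<comment> \<open>This is \<open>q\<close> times (-1) to the power
    \<open>\<delta> = p0 + 1\<close>: the sign \<open>- ((-1) ^ p)\<close> of the logarithmic
    coefficients, with \<open>p = p0 + l\<close>, leaves it after \<open>(-1) ^ l\<close> is split
    off.\<close>
  proof (intro exI[of _ "q * (-1) ^ (p0 + 1)"] allI)
    fix l :: nat
    define p where "p = p0 + l"
    obtain c where c: "\<And>z. norm z < 1 \<Longrightarrow> (\<lambda>k. c k * z ^ k) sums (Ln (1 - z) * (1 - z) ^ p)"
     "\<And>k. k > p \<Longrightarrow> c k = - ((-1) ^ p * fact p * fact (k - p - 1) / fact k)"
      using power_series_Ln_mult_power[of p] by blast
    define C where "C = (\<lambda>k. q * c k + \<Omega> * ((-1) ^ k * (of_nat p gchoose k)))"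
    have exponent: "\<delta> - 1 + of_nat l = of_nat p" by (simp add: \<delta> p_def)
    have 1: "(\<lambda>k. C k * z ^ k) sums ((q * Ln (1 - z) + \<Omega>) * (1 - z) powr (\<delta> - 1 + of_nat l))"
      if z: "norm z < 1" for z
    proof -
      have "1 - z \<noteq> 0" using z by auto
      hence pw: "(1 - z) powr of_nat p = (1 - z) ^ p" by (simp add: powr_nat')
      have "(\<lambda>k. (of_nat p gchoose k) * (-z) ^ k) sums (1 - z) ^ p"
        using gen_binomial_complex[of "-z" "of_nat p"] z pw by simp
      from sums_add[OF sums_mult[OF c(1)[OF z], of q] sums_mult[OF this, of \<Omega>]]
      show ?thesis unfolding exponent pw C_def by (simp add: algebra_simps power_minus[of z])
    qed
    \<comment> \<open>Beyond \<open>p\<close> the binomial coefficient vanishes, and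
      \<open>\<Omega>\<close> disappears with it.\<close>
    have C: "C k = - (q * (-1) ^ p * fact p) * (fact (k - (p + 1)) / fact k)" if "k > p" for k
      using c(2)[OF that] that by (simp add: C_def binomial_eq_0 flip: binomial_gbinomial)
    have 2: "\<forall>\<^sub>F k in sequentially. C k = (q * (-1) ^ (p0 + 1)) / Gamma (of_nat k + 1) *
       ((-1) ^ l * Gamma (of_nat l + \<delta>) * Gamma (of_nat k - of_nat l + 1 - \<delta>))"
      using eventually_gt_at_top[of p]
    proof eventually_elim
      case (elim k)
      have "Gamma (of_nat l + \<delta>) = fact p"
        using Gamma_fact[of p, where ?'a = complex] by (simp add: \<delta> p_def algebra_simps)
      moreover have "of_nat k - of_nat l + 1 - \<delta> = 1 + of_nat (k - (p + 1))"
        using elim by (simp add: \<delta> p_def of_nat_diff algebra_simps)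
      hence "Gamma (of_nat k - of_nat l + 1 - \<delta>) = fact (k - (p + 1))"
        by (simp only: Gamma_fact)
      moreover have "Gamma (of_nat k + 1 :: complex) = fact k"
        using Gamma_fact[of k, where ?'a = complex] by (simp add: add.commute)
      ultimately show ?case using C[OF elim] by (simp add: p_def power_add)
    qed
    have 3: "(\<lambda>k. norm (C k)) \<in> O(\<lambda>k. real k powr (- Re \<delta> - real l))"
    proof (rule bigoI)
      show "\<forall>\<^sub>F k in sequentially. norm (norm (C k)) \<le>
          (norm (q * (-1) ^ p * fact p) * 2 ^ (p + 1)) * norm (real k powr (- Re \<delta> - real l))"
        using eventually_ge_at_top[of "2 * (p + 1)"]
      proof eventually_elim
        case (elim k)
        have "norm (C k) = norm (q * (-1) ^ p * fact p) * (fact (k - (p + 1)) / fact k)"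
          using C[of k] elim by (simp add: norm_mult norm_divide)
        also have "\<dots> \<le> norm (q * (-1) ^ p * fact p) * (2 ^ (p + 1) * real k powr (- real (p + 1)))"
          by (intro mult_left_mono fact_diff_div_fact_le) (use elim in auto)
        also have "- real (p + 1) = - Re \<delta> - real l" by (simp add: \<delta> p_def)
        finally show ?case by simp
      qed
    qed
    show "\<exists>c. (\<forall>z. norm z < 1 \<longrightarrow> (\<lambda>k. c k * z ^ k) sums ((q * Ln (1 - z) + \<Omega>) * (1 - z) powr (\<delta> - 1 + of_nat l))) \<and>
      (\<forall>\<^sub>F k in sequentially. c k = (q * (-1) ^ (p0 + 1)) / Gamma (of_nat k + 1) *
       ((-1) ^ l * Gamma (of_nat l + \<delta>) * Gamma (of_nat k - of_nat l + 1 - \<delta>))) \<and>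
      (\<lambda>k. norm (c k)) \<in> O(\<lambda>k. real k powr (- Re \<delta> - real l))"
      using 1 2 3 by blast
  qed
qed

section \<open>The remainder after removal of the singular terms\<close>

lemma powr_bigo_powr_nat:
  "a \<le> b \<Longrightarrow> (\<lambda>k. real k powr a) \<in> O(\<lambda>k. real k powr b)"
  by (rule bigoI[of _ 1], rule eventually_mono[OF eventually_ge_at_top[of 1]]) (auto intro: powr_mono)

lemma power_series_split_off_polynomial:
  fixes a :: "nat \<Rightarrow> complex"
  assumes S: "\<And>w. norm w < e \<Longrightarrow> (\<lambda>k. a k * w ^ k) sums S w"
  obtains g where "g holomorphic_on ball 0 e"
    "\<And>w. norm w < e \<Longrightarrow> S w - (\<Sum>l\<le>m. a l * w ^ l) = w ^ Suc m * g w"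
proof -
  define g where "g = (\<lambda>w. \<Sum>k. a (k + Suc m) * w ^ k)"
  have tail: "(\<lambda>k. a (k + Suc m) * w ^ (k + Suc m)) sums (S w - (\<Sum>l\<le>m. a l * w ^ l))"
    if "norm w < e" for w
    using sums_split_initial_segment[OF S[OF that], of "Suc m"] by (simp add: lessThan_Suc_atMost)
  have g: "(\<lambda>k. a (k + Suc m) * w ^ k) sums g w" if "norm w < e" for w
  proof (cases "w = 0")
    case True
    thus ?thesis using powser_sums_zero[of "\<lambda>k. a (k + Suc m)"] by (simp add: g_def sums_iff)
  next
    case False
    have "(\<lambda>k. inverse (w ^ Suc m) * (a (k + Suc m) * w ^ (k + Suc m))) sums
        (inverse (w ^ Suc m) * (S w - (\<Sum>l\<le>m. a l * w ^ l)))"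
      by (intro sums_mult tail that)
    hence "summable (\<lambda>k. inverse (w ^ Suc m) * (a (k + Suc m) * w ^ (k + Suc m)))"
      by (rule sums_summable)
    also have "(\<lambda>k. inverse (w ^ Suc m) * (a (k + Suc m) * w ^ (k + Suc m))) = (\<lambda>k. a (k + Suc m) * w ^ k)"
      using False by (auto simp: power_add field_simps)
    finally show ?thesis unfolding g_def by (rule summable_sums)
  qed
  show ?thesis
  proof (rule that[of g])
    show "g holomorphic_on ball 0 e"
      by (rule power_series_holomorphic[of _ _ "\<lambda>k. a (k + Suc m)"]) (use g in auto)
    fix w :: complex assume w: "norm w < e"
    have "(\<lambda>k. a (k + Suc m) * w ^ (k + Suc m)) sums (w ^ Suc m * g w)"
      using sums_mult[OF g[OF w], of "w ^ Suc m"] by (simp add: power_add mult_ac)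
    with tail[OF w] show "S w - (\<Sum>l\<le>m. a l * w ^ l) = w ^ Suc m * g w"
      by (rule sums_unique2)
  qed
qed

text \<open>The first summand of \<open>R\<close> has a removable singularity at 1. In the second,
  dropping the terms up to \<open>m\<close> frees a factor \<open>(1 - z) ^ Suc m\<close>, raising
  the exponent to \<open>\<delta> + m\<close>, which is enough for \<open>N\<close> bounded
  derivatives.\<close>

lemma higher_deriv_bounded_near_singular_point:
  fixes u S R :: "complex \<Rightarrow> complex"
  assumes e: "e > 0"
    and R: "R holomorphic_on ball 0 1"
    and u: "u holomorphic_on ball 1 e"
    and S: "\<And>w. norm w < e \<Longrightarrow> (\<lambda>k. b k * w ^ k) sums S w"
    and R_eq: "\<And>z. z \<in> ball 0 1 \<inter> ball 1 e \<Longrightarrow> R z = (u z - u 1) / (1 - z) +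
       (q * Ln (1 - z) + \<Omega>) * (1 - z) powr (\<delta> - 1) * (S (1 - z) - (\<Sum>l\<le>m. b l * (1 - z) ^ l))"
    and m: "Re \<delta> + real m \<ge> real N + 1"
  shows "\<exists>e'>0. \<exists>K. \<forall>z\<in>ball 0 1 \<inter> ball 1 e'. norm ((deriv ^^ N) R z) \<le> K"
proof -
  define e1 where "e1 = min e 1"
  have e1: "e1 > 0" "e1 \<le> 1" "e1 \<le> e" using e by (auto simp: e1_def)
  obtain g where g: "g holomorphic_on ball 0 e"
    "\<And>w. norm w < e \<Longrightarrow> S w - (\<Sum>l\<le>m. b l * w ^ l) = w ^ Suc m * g w"
    using power_series_split_off_polynomial[where e = e and m = m, OF S] by blast
  have g': "(\<lambda>z. g (1 - z)) holomorphic_on ball 1 e1"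
    using e1 by (intro holomorphic_on_compose_gen[OF _ g(1), of "\<lambda>z. 1 - z", unfolded o_def]
                   holomorphic_on_diff holomorphic_on_const holomorphic_on_ident)
                (auto simp: dist_norm norm_minus_commute)
  \<comment> \<open>The holomorphic extension of \<open>(u z - u 1) / (1 - z)\<close> to 1; the
    outer minus sign turns \<open>z - 1\<close> into \<open>1 - z\<close>.\<close>
  define v where "v = (\<lambda>z. - (if z = 1 then deriv u 1 else (u z - u 1) / (z - 1)))"
  have v: "v holomorphic_on ball 1 e1"
    unfolding v_def using e1
    by (intro holomorphic_on_minus holomorphic_on_subset[OF pole_lemma_open[OF u]]) auto
  let ?V = "ball 0 1 \<inter> ball 1 e1 :: complex set"
  define F where "F = (\<lambda>z. R z - v z)"
  have RV: "R holomorphic_on ?V" and vV: "v holomorphic_on ?V"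
    using R v by (auto intro: holomorphic_on_subset)
  have FV: "F holomorphic_on ?V" unfolding F_def by (intro holomorphic_on_diff RV vV)
  have "\<exists>K. \<forall>z\<in>ball 0 1 \<inter> ball 1 (e1/2). norm ((deriv ^^ N) F z) \<le> K"
  proof (rule higher_deriv_bounded_near_branch_point[OF e1(1,2) FV,
      of "\<lambda>z. \<Omega> * g (1 - z)" "\<lambda>z. q * g (1 - z)" "\<delta> + of_nat m"])
    show "(\<lambda>z. \<Omega> * g (1 - z)) holomorphic_on ball 1 e1" "(\<lambda>z. q * g (1 - z)) holomorphic_on ball 1 e1"
      by (intro holomorphic_on_mult holomorphic_on_const g')+
    fix z assume z: "z \<in> ?V"
    have nz: "1 - z \<noteq> 0" using z by auto
    have ne: "norm (1 - z) < e" using z e1 by (auto simp: dist_norm)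
    have "(1 - z) powr (\<delta> - 1) * (1 - z) ^ Suc m = (1 - z) powr (\<delta> - 1) * (1 - z) powr (of_nat (Suc m))"
      using nz by (subst powr_nat') auto
    also have "\<dots> = (1 - z) powr (\<delta> - 1 + of_nat (Suc m))" by (rule powr_add[symmetric])
    also have "\<delta> - 1 + of_nat (Suc m) = \<delta> + of_nat m" by simp
    finally have pw: "(1 - z) powr (\<delta> - 1) * (1 - z) ^ Suc m = (1 - z) powr (\<delta> + of_nat m)" .
    have "v z = (u z - u 1) / (1 - z)"
      using nz unfolding v_def by (auto simp: divide_simps) (simp add: algebra_simps)
    hence "F z = (q * Ln (1 - z) + \<Omega>) * (1 - z) powr (\<delta> - 1) * ((1 - z) ^ Suc m * g (1 - z))"
      unfolding F_def using R_eq[of z] z e1 g(2)[OF ne] by auto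
    also have "\<dots> = ((1 - z) powr (\<delta> - 1) * (1 - z) ^ Suc m) * (\<Omega> * g (1 - z) + Ln (1 - z) * (q * g (1 - z)))"
      by (simp only: ring_distribs mult_ac add_ac)
    finally show "F z = (1 - z) powr (\<delta> + of_nat m) * (\<Omega> * g (1 - z) + Ln (1 - z) * (q * g (1 - z)))"
      unfolding pw .
  qed (use m in auto)
  then obtain K1 where K1: "\<And>z. z \<in> ball 0 1 \<inter> ball 1 (e1/2) \<Longrightarrow> norm ((deriv ^^ N) F z) \<le> K1" by blast
  have "(deriv ^^ N) v holomorphic_on ball 1 e1" by (intro holomorphic_higher_deriv v open_ball)
  then obtain K2 where K2: "\<And>z. z \<in> ball 1 (e1/2) \<Longrightarrow> norm ((deriv ^^ N) v z) \<le> K2"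
    using holomorphic_bounded_on_half_ball e1 by blast
  have "norm ((deriv ^^ N) R z) \<le> K1 + K2" if z: "z \<in> ball 0 1 \<inter> ball 1 (e1/2)" for z
  proof -
    have zV: "z \<in> ?V" using z e1 by auto
    have "(deriv ^^ N) R z = (deriv ^^ N) (\<lambda>z. F z + v z) z" unfolding F_def by simp
    also have "\<dots> = (deriv ^^ N) F z + (deriv ^^ N) v z"
      by (rule higher_deriv_add[OF FV vV _ zV]) auto
    finally show ?thesis
      using norm_triangle_ineq[of "(deriv ^^ N) F z" "(deriv ^^ N) v z"] K1[OF z] K2[of z] z by auto
  qed
  hence "\<exists>K. \<forall>z\<in>ball 0 1 \<inter> ball 1 (e1/2). norm ((deriv ^^ N) R z) \<le> K" by blast
  thus ?thesis using e1 by (intro exI[of _ "e1/2"]) simp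
qed

text \<open>Darboux's method in abstract form. At boundary points other than 1 smoothness comes from
  the system, at 1 from the explicit formula \<open>f_eq\<close>; nothing is assumed of
  \<open>f\<close> outside the disc. The coefficients \<open>m\<close> may be singular at 0, hence
  the punctured disc in \<open>ode\<close>.\<close>

lemma linear_ode_coeff_asymptotics:
  fixes f :: "'i::finite \<Rightarrow> complex \<Rightarrow> complex" and m :: "'i \<Rightarrow> 'i \<Rightarrow> complex \<Rightarrow> complex"
    and a b :: "'i \<Rightarrow> nat \<Rightarrow> complex"
  assumes \<delta>: "\<delta> \<noteq> 0" "Re \<delta> > -1" "\<delta> \<notin> \<int> \<Longrightarrow> q = 0"
    and W: "open W" "sphere 0 1 - {1} \<subseteq> W"
    and m: "\<And>i j. m i j holomorphic_on W"
    and ode: "\<And>i z. z \<in> ball 0 1 - {0} \<Longrightarrow> (f i has_field_derivative (\<Sum>j\<in>UNIV. m i j z * f j z)) (at z)"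
    and a: "\<And>i z. norm z < 1 \<Longrightarrow> (\<lambda>k. a i k * z ^ k) sums f i z"
    and e: "e > 0" and u: "\<And>i. u i holomorphic_on ball 1 e"
    and S: "\<And>i w. norm w < e \<Longrightarrow> (\<lambda>k. b i k * w ^ k) sums S i w"
    and f_eq: "\<And>i z. z \<in> ball 0 1 \<inter> ball 1 e \<Longrightarrow>
      f i z = u i z / (1 - z) + (q * Ln (1 - z) + \<Omega>) * (1 - z) powr (\<delta> - 1) * S i (1 - z)"
  shows "\<exists>\<omega>. \<forall>n i. (\<lambda>k. norm (a i k - u i 1 - \<omega> / Gamma (of_nat k + 1) *
      (\<Sum>l=0..n. (-1) ^ l * Gamma (of_nat l + \<delta>) * Gamma (of_nat k - of_nat l + 1 - \<delta>) * b i l)))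
      \<in> O(\<lambda>k. real k powr (- Re \<delta> - real n - 1))"
proof -
  define E where "E = (\<lambda>l z. (q * Ln (1 - z) + \<Omega>) * (1 - z) powr (\<delta> - 1 + of_nat l))"
  define T where "T = (\<lambda>l k. (-1) ^ l * Gamma (of_nat l + \<delta>) * Gamma (of_nat k - of_nat l + 1 - \<delta>))"
  obtain \<omega> where "\<forall>l. \<exists>c. (\<forall>z. norm z < 1 \<longrightarrow> (\<lambda>k. c k * z ^ k) sums E l z) \<and>
      (\<forall>\<^sub>F k in sequentially. c k = \<omega> / Gamma (of_nat k + 1) * T l k) \<and>
      (\<lambda>k. norm (c k)) \<in> O(\<lambda>k. real k powr (- Re \<delta> - real l))"
    using singular_term_coeffs[OF \<delta>, of \<Omega>] unfolding E_def T_def by blast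
  from choice[OF this] obtain c where c_sums: "\<And>l z. norm z < 1 \<Longrightarrow> (\<lambda>k. c l k * z ^ k) sums E l z"
    and c_ev: "\<And>l. \<forall>\<^sub>F k in sequentially. c l k = \<omega> / Gamma (of_nat k + 1) * T l k"
    and c_O: "\<And>l. (\<lambda>k. norm (c l k)) \<in> O(\<lambda>k. real k powr (- Re \<delta> - real l))"
    by blast
  have "(\<lambda>k. norm (a i k - u i 1 - \<omega> / Gamma (of_nat k + 1) * (\<Sum>l=0..n. T l k * b i l)))
      \<in> O(\<lambda>k. real k powr (- Re \<delta> - real n - 1))" for n i
  proof -
    \<comment> \<open>The least number of derivatives for which the power \<open>- N\<close> of
      \<open>k\<close> lies within the required error.\<close>
    define N where "N = nat \<lceil>Re \<delta> + real n + 1\<rceil>"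
    have N: "- real N \<le> - Re \<delta> - real n - 1" unfolding N_def by linarith
    \<comment> \<open>Since \<open>Re \<delta> > -1\<close>, subtracting the terms up to
      \<open>M\<close> leaves \<open>N\<close> bounded derivatives at 1. The terms with
      \<open>n < l \<le> M\<close> are subtracted only for smoothness and later rejoin the
      error.\<close>
    define M where "M = n + N + 2"
    have M: "Re \<delta> + real M \<ge> real N + 1" "n \<le> M" using \<delta> by (auto simp: M_def)
    define X where "X = (\<lambda>z. u i 1 / (1 - z) + (\<Sum>l\<le>M. b i l * E l z))"
    define R where "R = (\<lambda>z. f i z - X z)"
    define \<rho> where "\<rho> = (\<lambda>k. a i k - (u i 1 + (\<Sum>l\<le>M. b i l * c l k)))"
    have R_sums: "(\<lambda>k. \<rho> k * z ^ k) sums R z" if z: "norm z < 1" for z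
    proof -
      have "(\<lambda>k. a i k * z ^ k - (u i 1 * z ^ k + (\<Sum>l\<le>M. b i l * (c l k * z ^ k)))) sums
          (f i z - (u i 1 * (1 / (1 - z)) + (\<Sum>l\<le>M. b i l * E l z)))"
        by (intro sums_diff sums_add sums_mult sums_sum a c_sums geometric_sums z)
      thus ?thesis unfolding \<rho>_def R_def X_def
        by (simp add: ring_distribs sum_distrib_right mult.assoc)
    qed
    have R_hol: "R holomorphic_on ball 0 1"
      by (rule power_series_holomorphic[of _ _ \<rho>]) (use R_sums in auto)
    have "\<exists>e'>0. \<exists>K. \<forall>z\<in>ball 0 1 \<inter> ball c' e'. norm ((deriv ^^ N) R z) \<le> K"
      if c': "c' \<in> cball 0 1" for c' :: complex
    proof -
      consider "norm c' < 1" | "c' = 1" | "norm c' = 1" "c' \<noteq> 1" using c' by force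
      thus ?thesis
      proof cases
        case 1
        have "(deriv ^^ N) R holomorphic_on ball c' (1 - norm c')"
        proof (rule holomorphic_on_subset[OF holomorphic_higher_deriv[OF R_hol open_ball]])
          show "ball c' (1 - norm c') \<subseteq> ball 0 1" by (subst ball_subset_ball_iff) auto
        qed
        hence "\<exists>K. \<forall>z\<in>ball c' ((1 - norm c') / 2). norm ((deriv ^^ N) R z) \<le> K"
          by (rule holomorphic_bounded_on_half_ball) (use 1 in auto)
        thus ?thesis using 1 by (intro exI[of _ "(1 - norm c') / 2"]) auto
      next
        case 2
        show ?thesis unfolding 2
        proof (rule higher_deriv_bounded_near_singular_point[OF e R_hol u S _ M(1)])
          fix z :: complex assume z: "z \<in> ball 0 1 \<inter> ball 1 e"
          have nz: "1 - z \<noteq> 0" using z by auto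
          have E: "E l z = (q * Ln (1 - z) + \<Omega>) * (1 - z) powr (\<delta> - 1) * (1 - z) ^ l" for l
            using nz unfolding E_def by (simp add: powr_add powr_nat')
          show "R z = (u i z - u i 1) / (1 - z) + (q * Ln (1 - z) + \<Omega>) * (1 - z) powr (\<delta> - 1) *
              (S i (1 - z) - (\<Sum>l\<le>M. b i l * (1 - z) ^ l))"
            unfolding R_def X_def E f_eq[OF z]
            by (simp add: diff_divide_distrib right_diff_distrib sum_distrib_left mult_ac)
        qed
      next
        case 3
        have Re_c: "Re c' < 1"
        proof -
          have "Re c' \<le> 1" using complex_Re_le_cmod[of c'] 3 by simp
          moreover have "Re c' \<noteq> 1"
          proof
            assume "Re c' = 1"
            moreover from this have "Im c' = 0" using 3(1) by (simp add: cmod_def)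
            ultimately show False using 3(2) by (simp add: complex_eq_iff)
          qed
          ultimately show ?thesis by simp
        qed
        have "c' \<in> W" using W 3 by auto
        then obtain e0 where e0: "e0 > 0" "ball c' e0 \<subseteq> W" using W by (meson openE)
        \<comment> \<open>The bound \<open>1 - Re c'\<close> keeps \<open>1 - z\<close> off the
          branch cut, so \<open>X\<close> is holomorphic on the ball; the bound 1 keeps the singular
          point 0 outside it, as \<open>norm c' = 1\<close>.\<close>
        define e2 where "e2 = min e0 (min (1 - Re c') 1)"
        have e2: "e2 > 0" "e2 \<le> e0" "e2 \<le> 1 - Re c'" "e2 \<le> 1" using e0 Re_c by (auto simp: e2_def)
        let ?V = "ball 0 1 \<inter> ball c' e2"
        have np: "1 - z \<notin> \<real>\<^sub>\<le>\<^sub>0" if "z \<in> ball c' e2" for z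
        proof -
          have "Re z - Re c' \<le> norm (z - c')" using complex_Re_le_cmod[of "z - c'"] by simp
          also have "\<dots> < 1 - Re c'" using that e2 by (simp add: dist_norm norm_minus_commute)
          finally show ?thesis by (simp add: complex_nonpos_Reals_iff)
        qed
        have X_hol: "X holomorphic_on ball c' e2"
          unfolding X_def E_def using np by (intro holomorphic_intros) force+
        obtain e3 K1 where e3: "e3 > 0"
          and K1: "\<And>z. z \<in> ?V \<inter> ball c' e3 \<Longrightarrow> norm ((deriv ^^ N) (f i) z) \<le> K1"
        proof -
          have "\<exists>e'>0. \<exists>K. \<forall>z\<in>?V \<inter> ball c' e'. norm ((deriv ^^ N) (f i) z) \<le> K"
          proof (rule higher_deriv_bounded_near_regular_point[OF _ _ _ e2(1)])
            show "m i j holomorphic_on ball c' e2" for i j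
              by (rule holomorphic_on_subset[OF m]) (use e0 e2 in auto)
            show "(f i has_field_derivative (\<Sum>j\<in>UNIV. m i j z * f j z)) (at z)" if "z \<in> ?V" for i z
            proof (rule ode)
              have "z \<noteq> 0" using that e2 3 by (auto simp: dist_norm)
              thus "z \<in> ball 0 1 - {0}" using that by auto
            qed
          qed (auto intro: convex_Int)
          thus ?thesis using that by blast
        qed
        have "(deriv ^^ N) X holomorphic_on ball c' e2" by (intro holomorphic_higher_deriv X_hol open_ball)
        then obtain K2 where K2: "\<And>z. z \<in> ball c' (e2/2) \<Longrightarrow> norm ((deriv ^^ N) X z) \<le> K2"
          using holomorphic_bounded_on_half_ball e2 by blast
        have "norm ((deriv ^^ N) R z) \<le> K1 + K2" if z: "z \<in> ball 0 1 \<inter> ball c' (min e3 (e2/2))" for z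
        proof -
          have zV: "z \<in> ?V" using z e2 by auto
          have fV: "f i holomorphic_on ?V"
          proof (rule holomorphic_on_subset)
            show "f i holomorphic_on ball 0 1"
              by (rule power_series_holomorphic[of _ _ "a i"]) (use a in auto)
          qed auto
          have "(deriv ^^ N) R z = (deriv ^^ N) (f i) z - (deriv ^^ N) X z"
            unfolding R_def by (rule higher_deriv_diff[OF fV _ _ zV])
              (auto intro: holomorphic_on_subset[OF X_hol])
          thus ?thesis
            using norm_triangle_ineq4[of "(deriv ^^ N) (f i) z" "(deriv ^^ N) X z"] K1[of z] K2[of z] z zV by auto
        qed
        hence "\<exists>K. \<forall>z\<in>ball 0 1 \<inter> ball c' (min e3 (e2/2)). norm ((deriv ^^ N) R z) \<le> K" by blast
        thus ?thesis using e2 e3 by (intro exI[of _ "min e3 (e2/2)"]) simp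
      qed
    qed
    hence "\<exists>K. \<forall>z\<in>ball 0 1. norm ((deriv ^^ N) R z) \<le> K"
      by (intro bounded_of_locally_bounded_near_closure[of "cball 0 1"]) auto
    then obtain K where "\<forall>z\<in>ball 0 1. norm ((deriv ^^ N) R z) \<le> K" by blast
    hence K: "norm ((deriv ^^ N) R z) \<le> K" if "norm z < 1" for z using that by simp
    have \<rho>_O: "(\<lambda>k. norm (\<rho> k)) \<in> O(\<lambda>k. real k powr (- Re \<delta> - real n - 1))"
      by (rule landau_o.big_trans[OF power_series_coeff_bigo_of_bounded_higher_deriv[OF R_sums K]
            powr_bigo_powr_nat[OF N]])
    \<comment> \<open>Each auxiliary term has \<open>l \<ge> n + 1\<close>, so its coefficients are
      already of the order of the error.\<close>
    have tail_O: "(\<lambda>k. norm (\<rho> k) + (\<Sum>l\<in>{n<..M}. norm (b i l) * norm (c l k)))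
        \<in> O(\<lambda>k. real k powr (- Re \<delta> - real n - 1))"
    proof (intro sum_in_bigo(1)[OF \<rho>_O] big_sum_in_bigo)
      fix l assume "l \<in> {n<..M}"
      hence "- Re \<delta> - real l \<le> - Re \<delta> - real n - 1" by auto
      thus "(\<lambda>k. norm (b i l) * norm (c l k)) \<in> O(\<lambda>k. real k powr (- Re \<delta> - real n - 1))"
        using landau_o.big_trans[OF c_O powr_bigo_powr_nat] by simp
    qed
    have ev: "\<forall>\<^sub>F k in sequentially. \<forall>l\<in>{0..n}. c l k = \<omega> / Gamma (of_nat k + 1) * T l k"
      by (intro eventually_ball_finite ballI c_ev) auto
    show ?thesis
    proof (rule landau_o.big_trans[OF _ tail_O], rule bigoI[of _ 1])
      show "\<forall>\<^sub>F k in sequentially. norm (norm (a i k - u i 1 - \<omega> / Gamma (of_nat k + 1) * (\<Sum>l=0..n. T l k * b i l)))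
          \<le> 1 * norm (norm (\<rho> k) + (\<Sum>l\<in>{n<..M}. norm (b i l) * norm (c l k)))"
        using ev
      proof eventually_elim
        case (elim k)
        have "{..M} = {0..n} \<union> {n<..M}" using M by auto
        hence "(\<Sum>l\<le>M. b i l * c l k) = (\<Sum>l=0..n. b i l * c l k) + (\<Sum>l\<in>{n<..M}. b i l * c l k)"
          by (simp only:) (rule sum.union_disjoint, auto)
        also have "(\<Sum>l=0..n. b i l * c l k) = \<omega> / Gamma (of_nat k + 1) * (\<Sum>l=0..n. T l k * b i l)"
          unfolding sum_distrib_left by (intro sum.cong refl) (use elim in simp)
        finally have "a i k - u i 1 - \<omega> / Gamma (of_nat k + 1) * (\<Sum>l=0..n. T l k * b i l)
            = \<rho> k + (\<Sum>l\<in>{n<..M}. b i l * c l k)"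
          by (simp add: \<rho>_def)
        also have "norm \<dots> \<le> norm (\<rho> k) + (\<Sum>l\<in>{n<..M}. norm (b i l) * norm (c l k))"
          by (intro norm_triangle_le add_left_mono sum_norm_le) (simp add: norm_mult)
        finally show ?case by (simp add: sum_nonneg)
      qed
    qed
  qed
  thus ?thesis unfolding T_def by blast
qed

section \<open>Entries of the factored fundamental matrix\<close>

text \<open>Stated for a general index type, in which \<open>1 + 1\<close> may equal
  \<open>1\<close>; in that case \<open>vector\<close> keeps the first entry.\<close>

lemma vector_two_nth:
  fixes k :: "'c::{finite,one,plus}"
  shows "(vector [a, b] :: ('a::zero, 'c) vec) $ k = (if k = 1 then a else if k = 1 + 1 then b else 0)"
  unfolding vector_def by simp

text \<open>
  The dimension \<open>'c\<close> summed over in the second product is not determined by the types of the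
  outer factors. If \<open>1 + 1 = 1\<close> in \<open>'c\<close>, the product is singular; otherwise only the
  indices \<open>1\<close> and \<open>1 + 1\<close> contribute, as for \<open>'c = 2\<close>.
\<close>
lemma nonsingular_triangular_product_nth:
  fixes M Z :: "complex^2^2" and x y t :: complex
  assumes Z_eq: "Z = M ** (vector [vector [x, 0], vector [0, y]] :: (complex, 'c::{finite,one,plus}) vec ^ 2)
                 ** vector [vector [1, 0], vector [t, 1]]"
    and "det Z \<noteq> 0"
  shows "Z $ i $ 1 = M $ i $ 1 * x + M $ i $ 2 * y * t" and "Z $ i $ 2 = M $ i $ 2 * y"
proof -
  define N :: "(complex^2, 'c) vec" where "N = vector [vector [1, 0], vector [t, 1]]"
  define L :: "(complex, 'c) vec ^ 2" where "L = M ** vector [vector [x, 0], vector [0, y]]"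
  have L: "L $ i $ k = (if k = 1 then M $ i $ 1 * x else if k = 1 + 1 then M $ i $ 2 * y else 0)" for i k
    unfolding L_def by (simp add: matrix_matrix_mult_def sum_2 vector_two_nth)
  have Z: "Z $ i $ j = (\<Sum>k\<in>(UNIV::'c set). L $ i $ k * N $ k $ j)" for i j
    unfolding Z_eq N_def[symmetric] L_def[symmetric] by (simp add: matrix_matrix_mult_def)
  have ne: "(1::'c) + 1 \<noteq> 1"
  proof
    assume eq: "(1::'c) + 1 = 1"
    \<comment> \<open>Only one inner index contributes, so \<open>Z\<close> is a column times a row
      and has rank at most one.\<close>
    have "Z $ i $ j = M $ i $ 1 * x * N $ 1 $ j" for i j
    proof -
      have "Z $ i $ j = (\<Sum>k\<in>(UNIV::'c set). if k = 1 then M $ i $ 1 * x * N $ k $ j else 0)"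
        unfolding Z L eq by (intro sum.cong refl) auto
      thus ?thesis by simp
    qed
    hence "det Z = 0" by (simp add: det_2)
    with \<open>det Z \<noteq> 0\<close> show False by contradiction
  qed
  have "Z $ i $ j = M $ i $ 1 * x * N $ 1 $ j + M $ i $ 2 * y * N $ (1 + 1) $ j" for j
  proof -
    have "Z $ i $ j = (\<Sum>k\<in>(UNIV::'c set). (if k = 1 then M $ i $ 1 * x * N $ k $ j else 0)
        + (if k = 1 + 1 then M $ i $ 2 * y * N $ k $ j else 0))"
      unfolding Z L by (intro sum.cong refl) (use ne in auto)
    also have "\<dots> = M $ i $ 1 * x * N $ 1 $ j + M $ i $ 2 * y * N $ (1 + 1) $ j"
      by (simp add: sum.distrib)
    finally show ?thesis .
  qed
  thus "Z $ i $ 1 = M $ i $ 1 * x + M $ i $ 2 * y * t" "Z $ i $ 2 = M $ i $ 2 * y"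
    using ne by (simp_all add: N_def vector_two_nth[where 'c = 'c])
qed

section \<open>Application to the connection problem\<close>

theorem theorem3:
  fixes r :: ereal and A B :: "complex^2^2" and G :: "complex \<Rightarrow> complex^2^2"
    and \<alpha>0 \<beta>1 \<beta>2 q \<Theta> \<Omega> :: complex and a0 b1 b2 :: "complex^2"
    and h0 y0 :: "complex \<Rightarrow> complex^2" and H Y :: "complex \<Rightarrow> complex^2^2"
    and d dt :: "nat \<Rightarrow> complex^2"
    and D G0 G1 :: "complex set"
  assumes r: "1 < r"
    and D_def: "D = {z. ereal (cmod z) < r}"
    and G0_def: "G0 = D - {complex_of_real x | x. 1 \<le> x}"
    and G1_def: "G1 = D - {complex_of_real x | x. x \<le> 0}"
    and G_hol: "mat_holomorphic_on G D"
    \<comment> \<open>(a)\<close>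
    and a0_nz: "a0 \<noteq> 0" and a0_eig: "A *v a0 = \<alpha>0 *s a0"
    and A_inv: "\<And>k::nat. k \<ge> 1 \<Longrightarrow> invertible (A - mat (\<alpha>0 + of_nat k))"
    \<comment> \<open>(b)\<close>
    and \<beta>_ne: "\<beta>1 \<noteq> \<beta>2"
    and \<delta>_re: "Re (\<beta>2 - \<beta>1) > -1"
    and b1_nz: "b1 \<noteq> 0" and b1_eig: "B *v b1 = \<beta>1 *s b1"
    and b2_nz: "b2 \<noteq> 0" and b2_eig: "B *v b2 = \<beta>2 *s b2"
    \<comment> \<open>the solution y0 = z^alpha0 h0(z)\<close>
    and h0_hol: "vec_holomorphic_on h0 (ball 0 1)"
    and h0_0: "h0 0 = a0"
    and y0_sol: "solves_on (coef A B G) y0 (G0 \<inter> G1)"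
    and y0_eq: "\<And>z. z \<in> ball 0 1 \<inter> G1 \<Longrightarrow> y0 z = (z powr \<alpha>0) *s h0 z"
    \<comment> \<open>the fundamental matrix Y at z = 1\<close>
    and H_hol: "mat_holomorphic_on H G1"
    and H1_e1: "H 1 *v axis 1 1 = b1"
    and H1_e2: "H 1 *v axis 2 1 = b2"
    and q_zero: "\<beta>2 - \<beta>1 \<notin> \<int> \<Longrightarrow> q = 0"
    and Y_def: "\<And>z. Y z = H z
                 ** vector [vector [(1 - z) powr \<beta>1, 0], vector [0, (1 - z) powr \<beta>2]]
                 ** vector [vector [1, 0], vector [q * Ln (1 - z), 1]]"
    and Y_fund: "fundamental_matrix_on (coef A B G) Y (G0 \<inter> G1)"
    \<comment> \<open>connection coefficients\<close>
    and conn: "\<And>z. z \<in> G0 \<inter> G1 \<Longrightarrow> y0 z = Y z *v vector [\<Theta>, \<Omega>]"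
    \<comment> \<open>the coefficients d_k\<close>
    and d_def: "\<And>z. cmod z < 1 \<Longrightarrow>
                  (\<lambda>k. (z ^ k) *s d k) sums (((1 - z) powr (- \<beta>1 - 1)) *s h0 z)"
    \<comment> \<open>the coefficients dt_k (near z = 1)\<close>
    and dt_def: "\<exists>\<epsilon>>0. \<forall>z \<in> G0 \<inter> G1. cmod (z - 1) < \<epsilon> \<longrightarrow>
                  (\<exists>s. (\<lambda>k. ((1 - z) ^ k) *s dt k) sums s \<and>
                       ((1 - z) powr (- \<beta>1 - 1) * z powr (- \<alpha>0)) *s (Y z *v axis 2 1)
                         = ((1 - z) powr (\<beta>2 - \<beta>1 - 1)) *s s)"
  shows "\<exists>\<omega>::complex. \<forall>n::nat.
           (\<lambda>k::nat. norm (d k - \<Theta> *s b1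
              - (\<omega> / Gamma (of_nat k + 1)) *s
                  (\<Sum>l=0..n. ((-1) ^ l * Gamma (of_nat l + (\<beta>2 - \<beta>1))
                              * Gamma (of_nat k - of_nat l + 1 - (\<beta>2 - \<beta>1))) *s dt l)))
           \<in> O(\<lambda>k. real k powr (- Re (\<beta>2 - \<beta>1) - real n - 1))"
proof -
  define \<delta> where "\<delta> = \<beta>2 - \<beta>1"
  \<comment> \<open>The logarithm enters \<open>y0\<close> through the first column of
    \<open>Y\<close>, hence multiplied by \<open>\<Theta>\<close>; the abstract result is therefore
    used with \<open>\<Theta> * q\<close> in place of \<open>q\<close>.\<close>
  have \<delta>: "\<delta> \<noteq> 0" "Re \<delta> > -1" "\<delta> \<notin> \<int> \<Longrightarrow> \<Theta> * q = 0"
    using \<beta>_ne \<delta>_re q_zero by (auto simp: \<delta>_def)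
  have D_eq: "D = eball 0 r" unfolding D_def by (auto simp: eball_def)
  have D_open: "open D" unfolding D_eq by (rule open_eball)
  have in_D: "z \<in> D" if "norm z \<le> 1" for z
  proof -
    have "ereal (norm z) \<le> 1" using that by simp
    hence "ereal (norm z) < r" using r by (rule le_less_trans)
    thus ?thesis by (simp add: D_def)
  qed
  have G1_eq: "G1 = D - \<real>\<^sub>\<le>\<^sub>0"
    unfolding G1_def by (auto simp: nonpos_Reals_def image_def elim!: nonpos_Reals_cases)
  have G1_open: "open G1" unfolding G1_eq by (intro open_Diff D_open closed_nonpos_Reals_complex)
  have in_G0: "z \<in> G0" if "norm z < 1" for z
    using in_D[of z] that unfolding G0_def by auto
  have in_G1: "z \<in> G1" if "norm z < 1" "z \<notin> \<real>\<^sub>\<le>\<^sub>0" for z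
    using in_D[of z] that unfolding G1_eq by auto
  \<comment> \<open>The disc cut along the nonpositive axis: here \<open>y0\<close> is expressed
    through \<open>h0\<close>, the principal power of \<open>z\<close> is differentiable, and the
    system holds.\<close>
  define U where "U = ball 0 1 - (\<real>\<^sub>\<le>\<^sub>0 :: complex set)"
  have U: "open U" unfolding U_def by (intro open_Diff open_ball closed_nonpos_Reals_complex)
  have h0_eq: "h0 z $ i = z powr (- \<alpha>0) * y0 z $ i" if "z \<in> U" for z i
  proof -
    have z: "z \<noteq> 0" "z \<in> ball 0 1 \<inter> G1" using that in_G1[of z] unfolding U_def by auto
    show ?thesis unfolding y0_eq[OF z(2)] using z(1) by (simp add: powr_minus)
  qed
  define f where "f = (\<lambda>i z. (1 - z) powr (- \<beta>1 - 1) * h0 z $ i)"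
  \<comment> \<open>On \<open>U\<close>, \<open>f\<close> is \<open>y0\<close> times
    \<open>(1 - z) powr (- \<beta>1 - 1) * z powr (- \<alpha>0)\<close>. The logarithmic derivative
    of this scalar factor is added on the diagonal.\<close>
  define m where "m = (\<lambda>i j z. coef A B G z $ i $ j + (if i = j then (\<beta>1 + 1) / (1 - z) - \<alpha>0 / z else 0))"
  define W where "W = D - {0, 1}"
  have W: "open W" "sphere 0 1 - {1} \<subseteq> W"
    unfolding W_def using in_D by (auto intro!: open_Diff D_open finite_imp_closed)
  have G_hol': "(\<lambda>z. G z $ i $ j) holomorphic_on W" for i j
    using G_hol unfolding mat_holomorphic_on_def W_def by (blast intro: holomorphic_on_subset)
  have m_hol: "m i j holomorphic_on W" for i j
  proof -
    have "(\<lambda>z. (\<beta>1 + 1) / (1 - z) - \<alpha>0 / z) holomorphic_on W"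
      "(\<lambda>z. A $ i $ j / z + B $ i $ j / (z - 1) + G z $ i $ j) holomorphic_on W"
      by (intro holomorphic_intros G_hol'; auto simp: W_def)+
    thus ?thesis unfolding m_def coef_def by (cases "i = j") (auto intro: holomorphic_on_add)
  qed
  have f_hol: "f i holomorphic_on ball 0 1" for i
    unfolding f_def using h0_hol one_minus_notin_nonpos_Reals
    by (intro holomorphic_intros) (auto simp: vec_holomorphic_on_def)
  have ode_U: "(f i has_field_derivative (\<Sum>j\<in>UNIV. m i j z * f j z)) (at z)" if z: "z \<in> U" for i z
  proof -
    define p where "p = (\<lambda>z::complex. (1 - z) powr (- \<beta>1 - 1) * z powr (- \<alpha>0))"
    have np: "1 - z \<notin> \<real>\<^sub>\<le>\<^sub>0" "z \<notin> \<real>\<^sub>\<le>\<^sub>0" and nz: "1 - z \<noteq> 0" "z \<noteq> 0"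
      using z one_minus_notin_nonpos_Reals[of z] by (auto simp: U_def)
    have f_eq: "f j w = p w * y0 w $ j" if "w \<in> U" for j w
      unfolding f_def p_def h0_eq[OF that] by simp
    have pw: "(1 - z) powr (- \<beta>1 - 1 - 1) = (1 - z) powr (- \<beta>1 - 1) / (1 - z)"
        "z powr (- \<alpha>0 - 1) = z powr (- \<alpha>0) / z"
      using nz by (subst powr_diff; simp)+
    have "(p has_field_derivative
        (- \<beta>1 - 1) * (1 - z) powr (- \<beta>1 - 1 - 1) * (- 1) * z powr (- \<alpha>0) +
        (- \<alpha>0) * z powr (- \<alpha>0 - 1) * (1 - z) powr (- \<beta>1 - 1)) (at z)"
      unfolding p_def using np by (auto intro!: derivative_eq_intros)
    also have "(- \<beta>1 - 1) * (1 - z) powr (- \<beta>1 - 1 - 1) * (- 1) * z powr (- \<alpha>0) +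
        (- \<alpha>0) * z powr (- \<alpha>0 - 1) * (1 - z) powr (- \<beta>1 - 1) = ((\<beta>1 + 1) / (1 - z) - \<alpha>0 / z) * p z"
      unfolding pw p_def by (simp add: ring_distribs diff_divide_distrib add_divide_distrib mult_ac)
    finally have p': "(p has_field_derivative ((\<beta>1 + 1) / (1 - z) - \<alpha>0 / z) * p z) (at z)" .
    have zG: "z \<in> G0 \<inter> G1" using z in_G0[of z] in_G1[of z] by (auto simp: U_def)
    have y': "((\<lambda>w. y0 w $ i) has_field_derivative ((coef A B G z *v y0 z) $ i)) (at z)"
      using y0_sol zG unfolding solves_on_def by blast
    have "((\<lambda>w. p w * y0 w $ i) has_field_derivative
        ((\<beta>1 + 1) / (1 - z) - \<alpha>0 / z) * p z * y0 z $ i + (coef A B G z *v y0 z) $ i * p z) (at z)"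
      by (rule DERIV_mult[OF p' y'])
    also have "((\<beta>1 + 1) / (1 - z) - \<alpha>0 / z) * p z * y0 z $ i + (coef A B G z *v y0 z) $ i * p z
        = (\<Sum>j\<in>UNIV. m i j z * f j z)"
    proof -
      define \<kappa> where "\<kappa> = (\<beta>1 + 1) / (1 - z) - \<alpha>0 / z"
      have "m i j z = coef A B G z $ i $ j + (if i = j then \<kappa> else 0)" for j by (simp add: m_def \<kappa>_def)
      thus ?thesis unfolding f_eq[OF z] matrix_vector_mult_def \<kappa>_def[symmetric]
        using exhaust_2[of i] by (auto simp: sum_2 algebra_simps)
    qed
    finally show ?thesis
      by (rule has_field_derivative_transform_within_open[OF _ U z]) (use f_eq in auto)
  qed
  \<comment> \<open>The identity theorem carries the system across the cut: both sides are
    holomorphic on the connected punctured disc and agree on \<open>U\<close>.\<close>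
  have ode: "(f i has_field_derivative (\<Sum>j\<in>UNIV. m i j z * f j z)) (at z)" if z: "z \<in> ball 0 1 - {0}" for i z
  proof -
    have "deriv (f i) z = (\<Sum>j\<in>UNIV. m i j z * f j z)"
    proof (rule analytic_continuation_open[of U "ball 0 1 - {0}" "deriv (f i)" "\<lambda>z. \<Sum>j\<in>UNIV. m i j z * f j z"])
      show "U \<noteq> {}"
      proof -
        have "(1/2 :: complex) \<in> U" by (simp add: U_def complex_nonpos_Reals_iff norm_divide)
        thus ?thesis by blast
      qed
      show "connected (ball 0 1 - {0::complex})" by (rule connected_open_delete) auto
      show "U \<subseteq> ball 0 1 - {0}" by (auto simp: U_def)
      show "deriv (f i) holomorphic_on ball 0 1 - {0}"
        by (rule holomorphic_on_subset[OF holomorphic_deriv[OF f_hol open_ball]]) auto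
      have sub: "ball 0 1 - {0} \<subseteq> W" using in_D by (auto simp: W_def)
      show "(\<lambda>z. \<Sum>j\<in>UNIV. m i j z * f j z) holomorphic_on ball 0 1 - {0}"
        by (intro holomorphic_intros holomorphic_on_subset[OF m_hol sub] holomorphic_on_subset[OF f_hol]) auto
      show "deriv (f i) w = (\<Sum>j\<in>UNIV. m i j w * f j w)" if "w \<in> U" for w
        using ode_U[OF that] by (rule DERIV_imp_deriv)
    qed (use z U in auto)
    thus ?thesis using holomorphic_derivI[OF f_hol open_ball, of z i] z by auto
  qed
  have d_sums: "(\<lambda>k. d k $ i * z ^ k) sums f i z" if "norm z < 1" for i z
    using sums_vec_nth[OF d_def[OF that], of i] by (simp add: f_def mult.commute)
  obtain \<epsilon> where \<epsilon>: "\<epsilon> > 0" and dt: "\<forall>z \<in> G0 \<inter> G1. cmod (z - 1) < \<epsilon> \<longrightarrow>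
      (\<exists>s. (\<lambda>k. ((1 - z) ^ k) *s dt k) sums s \<and>
           ((1 - z) powr (- \<beta>1 - 1) * z powr (- \<alpha>0)) *s (Y z *v axis 2 1)
             = ((1 - z) powr (\<beta>2 - \<beta>1 - 1)) *s s)"
    using dt_def by (elim exE conjE)
  \<comment> \<open>\<open>1 - t\<close> is a real point at which \<open>dt\<close> guarantees
    convergence of the series in \<open>1 - z\<close>. Convergence at \<open>t\<close> yields
    convergence for all \<open>w\<close> with \<open>norm w < t\<close>, which makes
    \<open>S\<close> a genuine power series.\<close>
  define t where "t = min \<epsilon> 1 / 2"
  have t: "0 < t" "t < 1" "t < \<epsilon>" using \<epsilon> by (auto simp: t_def min_def)
  have "1 \<in> G1" using in_D[of 1] by (simp add: G1_eq complex_nonpos_Reals_iff)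
  then obtain e0 where e0: "e0 > 0" "ball 1 e0 \<subseteq> G1" using G1_open by (meson openE)
  define e where "e = min t e0"
  have e: "e > 0" "e \<le> t" "ball 1 e \<subseteq> G1" using t e0 by (auto simp: e_def)
  define S where "S = (\<lambda>i w. \<Sum>k. dt k $ i * w ^ k)"
  have S: "(\<lambda>k. dt k $ i * w ^ k) sums S i w" if w: "norm w < e" for i w
  proof -
    let ?z = "1 - complex_of_real t"
    have "norm ?z = \<bar>1 - t\<bar>" by (metis norm_of_real of_real_1 of_real_diff)
    hence "norm ?z < 1" using t by simp
    moreover have "?z \<notin> \<real>\<^sub>\<le>\<^sub>0" using t by (simp add: complex_nonpos_Reals_iff)
    ultimately have "?z \<in> G0 \<inter> G1" using in_G0 in_G1 by blast
    from bspec[OF dt this] t obtain s where "(\<lambda>k. (complex_of_real t ^ k) *s dt k) sums s" by auto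
    from sums_vec_nth[OF this, of i] have "summable (\<lambda>k. dt k $ i * complex_of_real t ^ k)"
      by (simp add: sums_iff mult.commute)
    hence "summable (\<lambda>k. dt k $ i * w ^ k)"
      by (rule powser_inside) (use w e t in auto)
    thus ?thesis unfolding S_def by (rule summable_sums)
  qed
  \<comment> \<open>The numerator of the pole term, coming from the first column of
    \<open>H\<close>. At 1 the power of \<open>z\<close> equals 1 and \<open>H 1\<close> sends the
    first basis vector to \<open>b1\<close>, so the pole contributes the constant
    \<open>\<Theta> *s b1\<close> to the coefficients.\<close>
  define u where "u = (\<lambda>i z. \<Theta> * z powr (- \<alpha>0) * H z $ i $ 1)"
  have u_hol: "u i holomorphic_on ball 1 e" for i
  proof -
    have "(\<lambda>z. H z $ i $ 1) holomorphic_on ball 1 e"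
      using H_hol e(3) unfolding mat_holomorphic_on_def by (blast intro: holomorphic_on_subset)
    thus ?thesis unfolding u_def using e(3) by (intro holomorphic_intros) (auto simp: G1_eq)
  qed
  have u1: "u i 1 = \<Theta> * b1 $ i" for i
    unfolding u_def H1_e1[symmetric] by (simp add: matrix_vector_mult_def sum_2 axis_def)
  have Y1: "Y z $ i $ 1 = H z $ i $ 1 * (1 - z) powr \<beta>1 + H z $ i $ 2 * (1 - z) powr \<beta>2 * (q * Ln (1 - z))"
    and Y2: "Y z $ i $ 2 = H z $ i $ 2 * (1 - z) powr \<beta>2" if "z \<in> G0 \<inter> G1" for i z
  proof -
    have "det (Y z) \<noteq> 0" using Y_fund that by (simp add: fundamental_matrix_on_def)
    from nonsingular_triangular_product_nth[OF Y_def this]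
    show "Y z $ i $ 1 = H z $ i $ 1 * (1 - z) powr \<beta>1 + H z $ i $ 2 * (1 - z) powr \<beta>2 * (q * Ln (1 - z))"
      "Y z $ i $ 2 = H z $ i $ 2 * (1 - z) powr \<beta>2" by blast+
  qed
  \<comment> \<open>The logarithmic part of the first column of \<open>Y\<close> is
    \<open>q * Ln (1 - z)\<close> times the second column. The connection formula thus collects the
    second column with the factor \<open>\<Theta> * q * Ln (1 - z) + \<Omega>\<close>, and
    \<open>dt\<close> rewrites that column through \<open>S\<close>.\<close>
  have f_eq: "f i z = u i z / (1 - z) + (\<Theta> * q * Ln (1 - z) + \<Omega>) * (1 - z) powr (\<delta> - 1) * S i (1 - z)"
    if z: "z \<in> ball 0 1 \<inter> ball 1 e" for i z
  proof -
    have zU: "z \<in> U" using z e(3) by (auto simp: U_def G1_eq)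
    have zG: "z \<in> G0 \<inter> G1" using z e(3) in_G0[of z] by auto
    have nz: "1 - z \<noteq> 0" using z by auto
    have ze: "norm (1 - z) < e" using z by (simp add: dist_norm)
    hence "cmod (z - 1) < \<epsilon>" using e t by (simp add: norm_minus_commute)
    from mp[OF bspec[OF dt zG] this] obtain s where s: "(\<lambda>k. ((1 - z) ^ k) *s dt k) sums s"
      "((1 - z) powr (- \<beta>1 - 1) * z powr (- \<alpha>0)) *s (Y z *v axis 2 1) = ((1 - z) powr (\<beta>2 - \<beta>1 - 1)) *s s"
      by blast
    have "s $ i = S i (1 - z)"
      using sums_vec_nth[OF s(1), of i] S[OF ze, of i] by (simp add: mult.commute sums_unique2)
    moreover have "(1 - z) powr (- \<beta>1 - 1) * z powr (- \<alpha>0) * Y z $ i $ 2 = (1 - z) powr (\<delta> - 1) * s $ i"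
      using arg_cong[OF s(2), of "\<lambda>v. v $ i"] by (simp add: matrix_vector_mult_def sum_2 axis_def \<delta>_def)
    ultimately have Y2': "(1 - z) powr (- \<beta>1 - 1) * z powr (- \<alpha>0) * (H z $ i $ 2 * (1 - z) powr \<beta>2)
        = (1 - z) powr (\<delta> - 1) * S i (1 - z)"
      by (simp add: Y2[OF zG])
    have P1: "(1 - z) powr (- \<beta>1 - 1) * (1 - z) powr \<beta>1 = 1 / (1 - z)"
      using nz by (simp add: powr_diff powr_minus)
    have "f i z = (1 - z) powr (- \<beta>1 - 1) * z powr (- \<alpha>0) * (Y z $ i $ 1 * \<Theta> + Y z $ i $ 2 * \<Omega>)"
      unfolding f_def h0_eq[OF zU] conn[OF zG] by (simp add: matrix_vector_mult_def sum_2)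
    also have "\<dots> = \<Theta> * z powr (- \<alpha>0) * H z $ i $ 1 * ((1 - z) powr (- \<beta>1 - 1) * (1 - z) powr \<beta>1)
        + (\<Theta> * q * Ln (1 - z) + \<Omega>) * ((1 - z) powr (- \<beta>1 - 1) * z powr (- \<alpha>0) * (H z $ i $ 2 * (1 - z) powr \<beta>2))"
      unfolding Y1[OF zG] Y2[OF zG] by (simp only: ring_distribs mult_ac add_ac)
    finally show ?thesis unfolding P1 Y2' u_def by (simp add: mult_ac)
  qed
  obtain \<omega> where \<omega>: "\<And>n i. (\<lambda>k. norm (d k $ i - u i 1 - \<omega> / Gamma (of_nat k + 1) *
      (\<Sum>l=0..n. (-1) ^ l * Gamma (of_nat l + \<delta>) * Gamma (of_nat k - of_nat l + 1 - \<delta>) * dt l $ i)))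
      \<in> O(\<lambda>k. real k powr (- Re \<delta> - real n - 1))"
    using linear_ode_coeff_asymptotics[where f = f and m = m and a = "\<lambda>i k. d k $ i" and b = "\<lambda>i k. dt k $ i"
        and u = u and S = S and q = "\<Theta> * q" and \<Omega> = \<Omega> and e = e and W = W and \<delta> = \<delta>,
        OF \<delta> W m_hol ode d_sums e(1) u_hol S f_eq] by blast
  show ?thesis
  proof (intro exI[of _ \<omega>] allI)
    fix n
    let ?v = "\<lambda>k. d k - \<Theta> *s b1 - (\<omega> / Gamma (of_nat k + 1)) *s
        (\<Sum>l=0..n. ((-1) ^ l * Gamma (of_nat l + (\<beta>2 - \<beta>1)) * Gamma (of_nat k - of_nat l + 1 - (\<beta>2 - \<beta>1))) *s dt l)"
    \<comment> \<open>The asymptotics are known by component with a common \<open>\<omega>\<close>;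
      the vector norm is then bounded by the sum of the component norms.\<close>
    have comp: "(\<lambda>k. norm (?v k $ i)) \<in> O(\<lambda>k. real k powr (- Re (\<beta>2 - \<beta>1) - real n - 1))" for i
      using \<omega>[of i n] by (simp add: u1 \<delta>_def)
    show "(\<lambda>k. norm (?v k)) \<in> O(\<lambda>k. real k powr (- Re (\<beta>2 - \<beta>1) - real n - 1))"
    proof (rule landau_o.big_trans[OF _ big_sum_in_bigo[of UNIV, OF comp]])
      show "(\<lambda>k. norm (?v k)) \<in> O(\<lambda>k. \<Sum>i\<in>UNIV. norm (?v k $ i))"
      proof (rule bigoI[of _ 1], rule always_eventually, rule allI)
        fix k
        have "norm (?v k) \<le> (\<Sum>i\<in>UNIV. norm (?v k $ i))"
          unfolding norm_vec_def by (rule L2_set_le_sum) simp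
        thus "norm (norm (?v k)) \<le> 1 * norm (\<Sum>i\<in>UNIV. norm (?v k $ i))"
          by (simp add: sum_nonneg del: sum_2)
      qed
    qed
  qed
qed

end
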